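(* The zero corner problem for $2$ matrices of dimension $3n_{\mathrm{P}}+2$ over $\mathbb{Z}$ is undecidable. That is, with $N=3n_{\mathrm{P}}+2$, the following problem is undecidable: given $A_1,A_2\in\mathbb{Z}^{N\times N}$, is there a finite sequence $i_1,\dots,i_k\in\{1,2\}$, $k\ge1$, such that $(A_{i_1}\cdots A_{i_k})_{1N}=0$?
   Context: $\mathbb{Z}$ is the ring of integers with its usual addition and multiplication. $n_{\mathrm{P}}$ denotes the minimal number $r$ of pairs of words for which Post's correspondence problem is undecidable, where Post's correspondence problem for $r$ pairs is: given pairs of words $(u_1,v_1),\dots,(u_r,v_r)$ over a finite alphabet, is there a finite sequence $1\le i_1,\dots,i_k\le r$, $k\ge1$, such that $u_{i_1}\cdots u_{i_k}=v_{i_1}\cdots v_{i_k}$? *)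

theory Defs
  imports
    Main
    "HOL-Library.Nat_Bijection"
    "Jordan_Normal_Form.Matrix"
begin

section \<open>Decision problems\<close>

datatype recf =
    Zero
  | Succ
  | Proj nat
  | Comp recf "recf list"
  | PrimRec recf recf
  | Mu recf

text \<open>
  Partial recursive functions, with \<open>rec_eval f xs y\<close> meaning that \<open>f\<close> is defined at the
  arguments \<open>xs\<close> and has value \<open>y\<close> there.  Arities are not recorded in the syntax;
  where the shape of the argument list fits no rule, the function is undefined.  In \<open>PrimRec\<close> and \<open>Mu\<close> the
  recursion variable, respectively the variable minimised over, is the first argument;
  in \<open>Mu\<close> all smaller values are required to be defined and nonzero.
\<close>

inductive rec_eval :: "recf \<Rightarrow> nat list \<Rightarrow> nat \<Rightarrow> bool" where
  zero: "rec_eval Zero xs 0"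
| succ: "rec_eval Succ [x] (Suc x)"
| proj: "i < length xs \<Longrightarrow> rec_eval (Proj i) xs (xs ! i)"
| comp: "length ys = length gs \<Longrightarrow> (\<forall>i<length gs. rec_eval (gs ! i) xs (ys ! i)) \<Longrightarrow>
    rec_eval f ys z \<Longrightarrow> rec_eval (Comp f gs) xs z"
| primrec_0: "rec_eval f xs y \<Longrightarrow> rec_eval (PrimRec f g) (0 # xs) y"
| primrec_Suc: "rec_eval (PrimRec f g) (n # xs) y \<Longrightarrow> rec_eval g (y # n # xs) z \<Longrightarrow>
    rec_eval (PrimRec f g) (Suc n # xs) z"
| mu: "rec_eval f (n # xs) 0 \<Longrightarrow> (\<forall>m<n. \<exists>k. rec_eval f (m # xs) (Suc k)) \<Longrightarrow>
    rec_eval (Mu f) xs n"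

inductive_cases rec_eval_ZeroE: "rec_eval Zero xs y"
inductive_cases rec_eval_SuccE: "rec_eval Succ xs y"
inductive_cases rec_eval_ProjE: "rec_eval (Proj i) xs y"
inductive_cases rec_eval_CompE: "rec_eval (Comp f gs) xs y"
inductive_cases rec_eval_PrimRec_0E: "rec_eval (PrimRec f g) (0 # xs) y"
inductive_cases rec_eval_PrimRec_SucE: "rec_eval (PrimRec f g) (Suc n # xs) y"
inductive_cases rec_eval_MuE: "rec_eval (Mu f) xs y"

lemma rec_eval_deterministic:
  "rec_eval f xs y \<Longrightarrow> rec_eval f xs z \<Longrightarrow> y = z"
proof (induction arbitrary: z rule: rec_eval.induct)
  case (zero xs)
  then show ?case by (auto elim: rec_eval_ZeroE)
next
  case (succ x)
  then show ?case by (auto elim: rec_eval_SuccE)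
next
  case (proj i xs)
  then show ?case by (auto elim: rec_eval_ProjE)
next
  case (comp ys gs xs f w)
  from comp.prems obtain ys' where ys': "length ys' = length gs"
      "\<forall>i<length gs. rec_eval (gs ! i) xs (ys' ! i)" "rec_eval f ys' z"
    by (rule rec_eval_CompE)
  have "ys = ys'"
    by (rule nth_equalityI) (use comp.hyps comp.IH ys' in auto)
  then show ?case
    using comp.IH ys' by blast
next
  case (primrec_0 f xs y g)
  then show ?case by (blast elim: rec_eval_PrimRec_0E)
next
  case (primrec_Suc f g n xs y w)
  from primrec_Suc.prems obtain y' where
      "rec_eval (PrimRec f g) (n # xs) y'" "rec_eval g (y' # n # xs) z"
    by (rule rec_eval_PrimRec_SucE)
  then show ?case
    using primrec_Suc.IH by blast
next
  case (mu f n xs)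
  from mu.prems have z: "rec_eval f (z # xs) 0" "\<forall>m<z. \<exists>k. rec_eval f (m # xs) (Suc k)"
    by (auto elim: rec_eval_MuE)
  show ?case
  proof (rule linorder_cases[of n z])
    assume "n < z"
    then obtain k where "rec_eval f (n # xs) (Suc k)" using z(2) by blast
    with mu.IH(1) show ?thesis by fastforce
  next
    assume "z < n"
    then obtain k where "\<forall>y. rec_eval f (z # xs) y \<longrightarrow> Suc k = y" using mu.IH(2) by blast
    with z(1) show ?thesis by blast
  qed
qed

text \<open>
  A decision problem consists of a set \<open>I\<close> of instances, a numbering \<open>code\<close> of the instances
  and a question \<open>P\<close>.  Nothing is required of the algorithm on numbers that do
  not code an instance.
\<close>

definition decidable :: "('a \<Rightarrow> nat) \<Rightarrow> 'a set \<Rightarrow> ('a \<Rightarrow> bool) \<Rightarrow> bool" where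
  "decidable code I P \<longleftrightarrow>
     (\<exists>f. \<forall>x\<in>I. rec_eval f [code x] (if P x then 1 else 0))"

section \<open>Post's correspondence problem\<close>

text \<open>
  Letters are natural numbers.  An instance mentions only finitely many letters, so this
  covers all finite alphabets up to renaming of letters.
\<close>

type_synonym word = "nat list"

definition pcp_instances :: "nat \<Rightarrow> (word \<times> word) list set" where
  "pcp_instances r = {ps. length ps = r}"

definition pcp_solvable :: "(word \<times> word) list \<Rightarrow> bool" where
  "pcp_solvable ps \<longleftrightarrow> (\<exists>is. is \<noteq> [] \<and> set is \<subseteq> {..<length ps} \<and>
     concat (map (\<lambda>i. fst (ps ! i)) is) = concat (map (\<lambda>i. snd (ps ! i)) is))"

definition pcp_code :: "(word \<times> word) list \<Rightarrow> nat" where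
  "pcp_code ps = list_encode (map (\<lambda>(u, v). prod_encode (list_encode u, list_encode v)) ps)"

definition pcp_decidable :: "nat \<Rightarrow> bool" where
  "pcp_decidable r \<longleftrightarrow> decidable pcp_code (pcp_instances r) pcp_solvable"

text \<open>
  The minimum exists because the problem is undecidable for some number of pairs (Post);
  this is not built into the definition.
\<close>

definition n_P :: nat where
  "n_P = (LEAST r. \<not> pcp_decidable r)"

section \<open>The zero corner problem\<close>

definition zc_instances :: "nat \<Rightarrow> nat \<Rightarrow> int mat list set" where
  "zc_instances k N = {As. length As = k \<and> set As \<subseteq> carrier_mat N N}"

text \<open>Matrix indices start at \<open>0\<close>, so the upper right corner is the entry \<open>(0, N - 1)\<close>.\<close>

definition zc_solvable :: "nat \<Rightarrow> int mat list \<Rightarrow> bool" where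
  "zc_solvable N As \<longleftrightarrow> (\<exists>is. is \<noteq> [] \<and> set is \<subseteq> {..<length As} \<and>
     foldr (\<lambda>i B. As ! i * B) is (1\<^sub>m N) $$ (0, N - 1) = 0)"

definition zc_code :: "int mat list \<Rightarrow> nat" where
  "zc_code As =
     list_encode (map (\<lambda>A. list_encode (map (\<lambda>row. list_encode (map int_encode row)) (mat_to_list A))) As)"

definition zc_decidable :: "nat \<Rightarrow> nat \<Rightarrow> bool" where
  "zc_decidable k N \<longleftrightarrow> decidable zc_code (zc_instances k N) (zc_solvable N)"

end

theory Submission
  imports Defs "HOL-Library.Countable"
begin

text \<open>
  Two facts are combined: Post's problem is undecidable for some number of pairs, without which
  \<open>n_P\<close> would be an unspecified number, and Post's problem with \<open>r\<close> pairs reduces by a recursive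
  function to the zero corner problem for two matrices of dimension \<open>3 * r + 2\<close>.

  For the first fact, a recursive function \<open>f\<close> is compiled to a program over registers
  (\<open>exec_halting_program\<close>), whose configurations are stored in a queue of letters.  A step removes
  at most two letters at the front and appends some at the end, so a halting run is a solution of
  \<open>w v\<^sub>1 \<dots> v\<^sub>n = u\<^sub>1 \<dots> u\<^sub>n f\<close>, an equation of Post's type with fixed ends
  (\<open>program_as_queue\<close>).  Separators turn it into Post's problem.  Altogether there is a list
  of pairs that depends on \<open>f\<close> only and becomes solvable, after adding a starting pair that
  depends on \<open>x\<close> only, iff \<open>f\<close> halts at \<open>x\<close> (\<open>halting_as_pcp\<close>).  Since solvability is in turn
  semidecidable, a diagonal argument on lists of pairs shows that some fixed number of pairs gives
  an undecidable problem (\<open>pcp_undecidable\<close>).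

  For the second fact, let \<open>M\<^sub>j\<close> be the matrix with rows \<open>(b ^ |u|, 0, 0)\<close>, \<open>(0, b ^ |v|, 0)\<close>,
  \<open>(value u, value v, 1)\<close> for the \<open>j\<close>-th pair \<open>(u, v)\<close>, where \<open>value w\<close> reads the word \<open>w\<close>
  as a numeral in a large base \<open>b\<close>.  For a sequence \<open>i \<dots> k\<close> of indices with upper word \<open>U\<close> and
  lower word \<open>V\<close>, the product \<open>(0, 0, 1) M\<^sub>i \<dots> M\<^sub>k (1, -1, 0)\<close> of row, matrices and column is
  \<open>value U - value V\<close>, which vanishes iff \<open>U = V\<close>.  The block diagonal matrix of the \<open>M\<^sub>j\<close> and a
  cyclic shift of the blocks generate all products of the \<open>M\<^sub>j\<close>.  One extra row and one extra column
  supply the vectors on both sides and move the value into the corner.  The extra column of the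
  shift is chosen such that a product ending in the shift has corner \<open>1\<close>; a product ending in the
  block diagonal matrix involves at least one index, as a solution of Post's problem must
  (\<open>zc_solvable_corner_matrices\<close>).
\<close>

section \<open>Recursive functions on codes\<close>

text \<open>
  Total recursive functions of one argument.  Several arguments, and lists, are passed through the
  bijections behind \<open>pcp_code\<close> and \<open>zc_code\<close>, so that closure under \<open>\<lambda>\<close>-expressions in one
  variable is all that the reductions need: \<open>h\<close> of two arguments is presented as
  \<open>\<lambda>z. h (proj1 z) (proj2 z)\<close>.
\<close>

definition computable :: "(nat \<Rightarrow> nat) \<Rightarrow> bool" where
  "computable g \<longleftrightarrow> (\<exists>f. \<forall>x. rec_eval f [x] (g x))"

definition computable2 :: "(nat \<Rightarrow> nat \<Rightarrow> nat) \<Rightarrow> bool" where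
  "computable2 g \<longleftrightarrow> (\<exists>f. \<forall>x y. rec_eval f [x, y] (g x y))"

lemma rec_eval_Proj: "i < length xs \<Longrightarrow> y = xs ! i \<Longrightarrow> rec_eval (Proj i) xs y"
  by (simp add: rec_eval.proj)

lemma rec_eval_Comp1: "rec_eval g xs y \<Longrightarrow> rec_eval f [y] z \<Longrightarrow> rec_eval (Comp f [g]) xs z"
  by (rule rec_eval.comp[where ys = "[y]"]) auto

lemma rec_eval_Comp2:
  "rec_eval g xs y \<Longrightarrow> rec_eval g' xs y' \<Longrightarrow> rec_eval f [y, y'] z \<Longrightarrow> rec_eval (Comp f [g, g']) xs z"
  by (rule rec_eval.comp[where ys = "[y, y']"]) (auto simp: less_Suc_eq)

lemma computable_id: "computable (\<lambda>x. x)"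
  unfolding computable_def by (intro exI[of _ "Proj 0"] allI rec_eval_Proj) auto

lemma computable_Suc: "computable f \<Longrightarrow> computable (\<lambda>x. Suc (f x))"
  unfolding computable_def by (meson rec_eval_Comp1 rec_eval.succ)

lemma computable_const: "computable (\<lambda>x. c)"
proof (induction c)
  case 0
  show ?case unfolding computable_def using rec_eval.zero by blast
qed (rule computable_Suc)

lemma computable_comp: "computable f \<Longrightarrow> computable g \<Longrightarrow> computable (\<lambda>x. f (g x))"
  unfolding computable_def by (meson rec_eval_Comp1)

lemma computable2_comp:
  "computable2 h \<Longrightarrow> computable f \<Longrightarrow> computable g \<Longrightarrow> computable (\<lambda>x. h (f x) (g x))"
  unfolding computable_def computable2_def by (meson rec_eval_Comp2)

lemma computable2_swap: "computable2 h \<Longrightarrow> computable2 (\<lambda>x y. h y x)"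
  unfolding computable2_def
proof (elim exE)
  fix f assume f: "\<forall>x y. rec_eval f [x, y] (h x y)"
  show "\<exists>f. \<forall>x y. rec_eval f [x, y] (h y x)"
    by (intro exI[of _ "Comp f [Proj 1, Proj 0]"] allI)
      (rule rec_eval_Comp2[OF rec_eval_Proj rec_eval_Proj f[rule_format]], auto)
qed

lemma computable2_snd: "computable f \<Longrightarrow> computable2 (\<lambda>x y. f y)"
  unfolding computable_def computable2_def
proof (elim exE)
  fix g assume g: "\<forall>x. rec_eval g [x] (f x)"
  show "\<exists>g. \<forall>x y. rec_eval g [x, y] (f y)"
    by (intro exI[of _ "Comp g [Proj 1]"] allI)
      (rule rec_eval_Comp1[OF rec_eval_Proj g[rule_format]], auto)
qed

text \<open>
  Iteration is the form of primitive recursion that suits functions of one argument: addition,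
  truncated subtraction, multiplication and folds over coded lists are all iterations.
\<close>

lemma computable2_funpow:
  assumes "computable2 h" "computable i"
  shows "computable2 (\<lambda>n x. (h x ^^ n) (i x))"
proof -
  obtain fh fi where fh: "\<And>x y. rec_eval fh [x, y] (h x y)" and fi: "\<And>x. rec_eval fi [x] (i x)"
    using assms unfolding computable_def computable2_def by blast
  have "rec_eval (PrimRec fi (Comp fh [Proj 2, Proj 0])) [n, x] ((h x ^^ n) (i x))" for n x
  proof (induction n)
    case 0
    then show ?case using rec_eval.primrec_0[OF fi] by simp
  next
    case (Suc n)
    show ?case
      by (rule rec_eval.primrec_Suc[OF Suc]) 
        (auto intro!: rec_eval_Comp2 rec_eval_Proj fh)
  qed
  then show ?thesis unfolding computable2_def by blast
qed

lemma computable2_add: "computable2 (+)"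
proof -
  have "(Suc ^^ n) x = n + x" for n x by (induction n) auto
  then show ?thesis
    using computable2_funpow[OF computable2_snd[OF computable_Suc[OF computable_id]] computable_id]
    by simp
qed

lemmas computable_add = computable2_comp[OF computable2_add]

lemma computable_pred: "computable (\<lambda>x. x - 1)"
proof -
  have "rec_eval (PrimRec Zero (Proj 1)) [n] (n - 1)" for n
    by (induction n) (auto intro!: rec_eval.primrec_0 rec_eval.zero rec_eval.primrec_Suc
        rec_eval_Proj)
  then show ?thesis unfolding computable_def by blast
qed

lemma computable2_diff: "computable2 (-)"
proof -
  have "((\<lambda>s. s - 1) ^^ n) x = x - n" for n x :: nat by (induction n) auto
  then show ?thesis
    using computable2_swap[OF computable2_funpow[OF computable2_snd[OF computable_pred]
        computable_id]]
    by simp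
qed

lemmas computable_diff = computable2_comp[OF computable2_diff]

lemma computable2_mult: "computable2 (*)"
proof -
  have "((+) x ^^ n) 0 = n * x" for n x :: nat by (induction n) auto
  then show ?thesis
    using computable2_funpow[OF computable2_add computable_const[of 0]] by simp
qed

lemmas computable_mult = computable2_comp[OF computable2_mult]

lemma computable_if_zero:
  assumes "computable c" "computable f" "computable g"
  shows "computable (\<lambda>x. if c x = 0 then f x else g x)"
proof -
  have "(if c x = 0 then f x else g x) = (1 - c x) * f x + (1 - (1 - c x)) * g x" for x
    by auto
  then show ?thesis
    by (auto intro!: computable_add computable_mult computable_diff computable_const assms)
qed

lemma computable_if_eq:
  assumes "computable a" "computable b" "computable f" "computable g"
  shows "computable (\<lambda>x. if a x = b x then f x else g x)"
proof -
  have "(a x = b x) = ((a x - b x) + (b x - a x) = 0)" for x by auto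
  then show ?thesis
    by (auto simp only: intro!: computable_if_zero computable_add computable_diff assms)
qed

lemma computable_if_less:
  assumes "computable a" "computable b" "computable f" "computable g"
  shows "computable (\<lambda>x. if a x < b x then f x else g x)"
proof -
  have "(a x < b x) = (Suc (a x) - b x = 0)" for x by auto
  then show ?thesis
    by (auto simp only: intro!: computable_if_zero computable_Suc computable_diff assms)
qed

lemma computable_Least:
  assumes "computable2 c" "\<And>x. \<exists>n. c n x = 0"
  shows "computable (\<lambda>x. LEAST n. c n x = 0)"
proof -
  obtain f where f: "\<And>n x. rec_eval f [n, x] (c n x)"
    using assms(1) unfolding computable2_def by blast
  have "rec_eval (Mu f) [x] (LEAST n. c n x = 0)" for x
  proof (rule rec_eval.mu)
    show "rec_eval f [LEAST n. c n x = 0, x] 0"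
      using f[of "LEAST n. c n x = 0" x] LeastI_ex[OF assms(2)[of x]] by simp
    show "\<forall>m<LEAST n. c n x = 0. \<exists>k. rec_eval f [m, x] (Suc k)"
      using f not_less_Least by (metis not0_implies_Suc)
  qed
  then show ?thesis unfolding computable_def by blast
qed

lemma computable_triangle: "computable triangle"
proof -
  obtain add where add: "\<And>x y. rec_eval add [x, y] (x + y)"
    using computable2_add unfolding computable2_def by blast
  have "rec_eval (PrimRec Zero (Comp Succ [Comp add [Proj 0, Proj 1]])) [n] (triangle n)" for n
  proof (induction n)
    case 0
    show ?case by (auto intro: rec_eval.primrec_0 rec_eval.zero)
  next
    case (Suc n)
    have "rec_eval (Comp Succ [Comp add [Proj 0, Proj 1]]) [triangle n, n] (Suc (triangle n + n))"
      by (rule rec_eval_Comp1[OF rec_eval_Comp2[OF rec_eval_Proj rec_eval_Proj add] rec_eval.succ])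
          auto
    then show ?case using rec_eval.primrec_Suc[OF Suc] by simp
  qed
  then show ?thesis unfolding computable_def by blast
qed

abbreviation pair :: "nat \<Rightarrow> nat \<Rightarrow> nat" where "pair x y \<equiv> prod_encode (x, y)"
abbreviation proj1 :: "nat \<Rightarrow> nat" where "proj1 z \<equiv> fst (prod_decode z)"
abbreviation proj2 :: "nat \<Rightarrow> nat" where "proj2 z \<equiv> snd (prod_decode z)"

lemma computable_pair: "computable f \<Longrightarrow> computable g \<Longrightarrow> computable (\<lambda>x. pair (f x) (g x))"
  by (simp add: prod_encode_def)
    (intro computable_add computable_comp[OF computable_triangle])

text \<open>
  Decoding a pair: \<open>triangle n\<close> is the number of pairs on the diagonals below \<open>n\<close>, so the diagonal
  \<open>proj1 z + proj2 z\<close> of \<open>z\<close> is the least \<open>n\<close> with \<open>z < triangle (Suc n)\<close>.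
\<close>

lemma computable_diagonal: "computable (\<lambda>z. proj1 z + proj2 z)"
proof -
  have mono: "triangle a \<le> triangle b" if "a \<le> b" for a b
    using that by (induction rule: dec_induct) auto
  have "(LEAST n. Suc z - triangle (Suc n) = 0) = proj1 z + proj2 z" for z
  proof -
    obtain a b where z: "prod_decode z = (a, b)" by force
    then have z': "z = triangle (a + b) + a"
      using prod_decode_inverse[of z] by (simp add: prod_encode_def)
    have "(LEAST n. Suc z - triangle (Suc n) = 0) = a + b"
    proof (rule Least_equality)
      fix n assume n: "Suc z - triangle (Suc n) = 0"
      show "a + b \<le> n"
      proof (rule ccontr)
        assume "\<not> a + b \<le> n"
        then have "triangle (Suc n) \<le> triangle (a + b)" by (intro mono) simp
        with n z' show False by linarith
      qed
    qed (simp add: z')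
    with z show ?thesis by simp
  qed
  moreover have "computable (\<lambda>z. LEAST n. Suc z - triangle (Suc n) = 0)"
  proof (rule computable_Least)
    have "computable (\<lambda>n. triangle (Suc n))"
      by (intro computable_comp[OF computable_triangle] computable_Suc computable_id)
    moreover have "computable2 (\<lambda>n z. Suc z - g n)" if g: "computable g" for g
    proof -
      obtain fd fg where fd: "\<And>x y. rec_eval fd [x, y] (x - y)" and fg: "\<And>x. rec_eval fg [x] (g x)"
        using computable2_diff g unfolding computable2_def computable_def by blast
      have "rec_eval (Comp fd [Comp Succ [Proj 1], Comp fg [Proj 0]]) [n, z] (Suc z - g n)" for n z
        by (rule rec_eval_Comp2[OF rec_eval_Comp1[OF rec_eval_Proj rec_eval.succ]
              rec_eval_Comp1[OF rec_eval_Proj fg] fd]) auto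
      then show ?thesis unfolding computable2_def by blast
    qed
    ultimately show "computable2 (\<lambda>n z. Suc z - triangle (Suc n))" by blast
    show "\<exists>n. Suc z - triangle (Suc n) = 0" for z
      by (intro exI[of _ z]) (simp add: triangle_def)
  qed
  ultimately show ?thesis by simp
qed

lemma computable_proj1: "computable f \<Longrightarrow> computable (\<lambda>x. proj1 (f x))"
proof -
  have "z - triangle (proj1 z + proj2 z) = proj1 z" for z
    using prod_decode_inverse[of z] by (cases "prod_decode z") (simp add: prod_encode_def)
  moreover have "computable (\<lambda>z. z - triangle (proj1 z + proj2 z))"
    by (intro computable_diff computable_id computable_comp[OF computable_triangle]
        computable_diagonal)
  ultimately have "computable proj1" by simp
  then show "computable f \<Longrightarrow> ?thesis" by (rule computable_comp)
qed

lemma computable_proj2: "computable f \<Longrightarrow> computable (\<lambda>x. proj2 (f x))"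
proof -
  have "computable (\<lambda>z. (proj1 z + proj2 z) - proj1 z)"
    by (intro computable_diff computable_diagonal computable_proj1 computable_id)
  then have "computable proj2" by simp
  then show "computable f \<Longrightarrow> ?thesis" by (rule computable_comp)
qed

lemma computable2I:
  assumes "computable (\<lambda>z. h (proj1 z) (proj2 z))"
  shows "computable2 h"
proof -
  obtain f where f: "\<And>z. rec_eval f [z] (h (proj1 z) (proj2 z))"
    using assms unfolding computable_def by blast
  have pr: "computable2 pair"
  proof -
    obtain fa ft where fa: "\<And>x y. rec_eval fa [x, y] (x + y)" and ft: "\<And>x. rec_eval ft [x] (triangle
        x)"
      using computable2_add computable_triangle unfolding computable2_def computable_def by blast
    have "rec_eval (Comp fa [Comp ft [Comp fa [Proj 0, Proj 1]], Proj 0]) [x, y] (pair x y)" for x y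
      unfolding prod_encode_def prod.case
      by (rule rec_eval_Comp2[OF rec_eval_Comp1[OF rec_eval_Comp2[OF rec_eval_Proj rec_eval_Proj fa]
          ft]
              rec_eval_Proj fa]) auto
    then show ?thesis unfolding computable2_def by blast
  qed
  then obtain p where "\<And>x y. rec_eval p [x, y] (pair x y)" unfolding computable2_def by blast
  then have "rec_eval (Comp f [p]) [x, y] (h x y)" for x y
    using rec_eval_Comp1 f[of "pair x y"] by fastforce
  then show ?thesis unfolding computable2_def by blast
qed

lemma computable_funpow:
  assumes "computable (\<lambda>z. h (proj1 z) (proj2 z))" "computable n" "computable i"
  shows "computable (\<lambda>x. (h x ^^ n x) (i x))"
  using computable2_comp[OF computable2_funpow[OF computable2I[OF assms(1)] assms(3)] assms(2)
    computable_id] .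

lemmas computable_intros =
  computable_const computable_id computable_Suc computable_add computable_diff
  computable_if_zero computable_if_eq computable_if_less
  computable_mult computable_pair computable_proj1 computable_proj2

lemma length_le_list_encode: "length xs \<le> list_encode xs"
  by (induction xs) (auto intro: le_trans[OF _ le_prod_encode_2])

text \<open>
  A fold over a coded list runs a loop whose state pairs the rest of the list with the accumulator.
  The code of a list bounds its length, and the step leaves an empty rest alone, so it is safe to
  iterate as often as the code says.
\<close>

lemma computable_foldl:
  assumes h: "computable (\<lambda>z. h (proj1 z) (proj1 (proj2 z)) (proj2 (proj2 z)))"
    and "computable i" "computable l"
  shows "computable (\<lambda>x. foldl (h x) (i x) (list_decode (l x)))"
proof -
  define step where "step x s = (if proj1 s = 0 then s
    else pair (proj2 (proj1 s - 1)) (h x (proj2 s) (proj1 (proj1 s - 1))))" for x s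
  have "proj2 ((step x ^^ n) (pair (list_encode as) a)) = foldl (h x) a as"
    if "length as \<le> n" for as a x n
    using that
  proof (induction n arbitrary: as a)
    case (Suc n)
    have "step x (pair 0 a) = pair 0 a" by (simp add: step_def)
    moreover have "step x (pair (list_encode (b # bs)) a) = pair (list_encode bs) (h x a b)" for b bs
      by (simp add: step_def)
    ultimately show ?case
      using Suc.prems Suc.IH[of "[]" a] Suc.IH[of "tl as"]
      by (cases as) (simp_all add: funpow_Suc_right del: funpow.simps)
  qed simp
  from this[OF length_le_list_encode]
  have "foldl (h x) (i x) (list_decode (l x)) = proj2 ((step x ^^ l x) (pair (l x) (i x)))" for x
    by (metis list_decode_inverse)
  moreover have "computable (\<lambda>x. proj2 ((step x ^^ l x) (pair (l x) (i x))))"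
  proof (intro computable_intros computable_funpow assms)
    have "computable (\<lambda>z. h (proj1 z) (proj2 (proj2 z)) (proj1 (proj1 (proj2 z) - 1)))"
      using computable_comp[OF h, of "\<lambda>z. pair (proj1 z) (pair (proj2 (proj2 z)) (proj1 (proj1
          (proj2 z) - 1)))"]
      by (simp add: computable_intros del: One_nat_def)
    then show "computable (\<lambda>z. step (proj1 z) (proj2 z))"
      unfolding step_def by (intro computable_intros)
  qed
  ultimately show ?thesis by simp
qed

lemma computable_list_encode_map:
  "(\<And>i. i \<in> set is \<Longrightarrow> computable (g i)) \<Longrightarrow> computable (\<lambda>x. list_encode (map (\<lambda>i. g i x) is))"
  by (induction "is") (auto intro!: computable_intros)

definition code_nth :: "nat \<Rightarrow> nat \<Rightarrow> nat" where
  "code_nth c i = proj1 (((\<lambda>c. proj2 (c - 1)) ^^ i) c - 1)"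

lemma code_nth_list_encode: "i < length xs \<Longrightarrow> code_nth (list_encode xs) i = xs ! i"
proof (induction xs arbitrary: i)
  case (Cons a xs)
  then show ?case
    by (cases i) (auto simp: code_nth_def funpow_Suc_right simp del: funpow.simps)
qed simp

lemma computable_code_nth:
  "computable f \<Longrightarrow> computable g \<Longrightarrow> computable (\<lambda>x. code_nth (f x) (g x))"
  unfolding code_nth_def
  by (intro computable_intros computable_funpow)

section \<open>Register programs for recursive functions\<close>

text \<open>
  \<open>Loop r b\<close> decrements \<open>r\<close> before each run of \<open>b\<close> and stops when \<open>r\<close> is zero.  Combining test and
  decrement leaves only two instructions for the word encoding to deal with.
\<close>

datatype instr = Inc nat | Loop nat "instr list"

type_synonym store = "nat \<Rightarrow> nat"

text \<open>
  The rules keep the whole remaining program as the first argument.  Every rule except the first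
  is thus one machine step, and an induction over \<open>exec\<close> follows a run configuration by
  configuration, while \<open>exec_append\<close> recovers the compositional view.
\<close>

inductive exec :: "instr list \<Rightarrow> store \<Rightarrow> store \<Rightarrow> bool" where
  exec_Nil: "exec [] s s"
| exec_Inc: "exec k (s(r := Suc (s r))) t \<Longrightarrow> exec (Inc r # k) s t"
| exec_Loop_zero: "s r = 0 \<Longrightarrow> exec k s t \<Longrightarrow> exec (Loop r b # k) s t"
| exec_Loop_Suc: "s r = Suc n \<Longrightarrow> exec (b @ Loop r b # k) (s(r := n)) t \<Longrightarrow> exec (Loop r b # k) s t"

inductive_cases exec_NilE: "exec [] s t"
inductive_cases exec_IncE: "exec (Inc r # k) s t"
inductive_cases exec_LoopE: "exec (Loop r b # k) s t"

lemma exec_Nil_iff [simp]: "exec [] s t \<longleftrightarrow> t = s"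
  by (auto elim: exec_NilE intro: exec.intros)

lemma exec_append: "exec (p @ q) s t \<longleftrightarrow> (\<exists>u. exec p s u \<and> exec q u t)"
proof
  have "exec pq s t \<Longrightarrow> pq = p @ q \<Longrightarrow> \<exists>u. exec p s u \<and> exec q u t" for pq
  proof (induction arbitrary: p rule: exec.induct)
    case (exec_Nil s)
    then show ?case by (auto intro: exec.intros)
  next
    case (exec_Inc k s r t)
    show ?case
    proof (cases p)
      case Nil
      then show ?thesis using exec_Inc by (auto intro: exec.intros)
    next
      case (Cons i p')
      then have "k = p' @ q" "i = Inc r" using exec_Inc.prems by auto
      with exec_Inc.IH obtain u where "exec p' (s(r := Suc (s r))) u" "exec q u t" by blast
      then show ?thesis using Cons \<open>i = Inc r\<close> by (blast intro: exec.exec_Inc)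
    qed
  next
    case (exec_Loop_zero s r k t b)
    then show ?case
      by (cases p) (auto intro: exec.intros)
  next
    case (exec_Loop_Suc s r n b k t)
    show ?case
    proof (cases p)
      case Nil
      then show ?thesis using exec_Loop_Suc by (auto intro: exec.intros)
    next
      case (Cons i p')
      then have eq: "b @ Loop r b # k = (b @ Loop r b # p') @ q" "i = Loop r b"
        using exec_Loop_Suc.prems by auto
      obtain u where "exec (b @ Loop r b # p') (s(r := n)) u" "exec q u t"
        using exec_Loop_Suc.IH[OF eq(1)] by blast
      then show ?thesis
        using exec_Loop_Suc.hyps Cons eq(2) by (blast intro: exec.exec_Loop_Suc)
    qed
  qed
  then show "exec (p @ q) s t \<Longrightarrow> \<exists>u. exec p s u \<and> exec q u t" by blast
  have "exec p s u \<Longrightarrow> exec q u t \<Longrightarrow> exec (p @ q) s t" for u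
    by (induction rule: exec.induct) (auto intro: exec.intros)
  then show "\<exists>u. exec p s u \<and> exec q u t \<Longrightarrow> exec (p @ q) s t" by blast
qed

lemma exec_Inc_iff [simp]: "exec (Inc r # k) s t \<longleftrightarrow> exec k (s(r := Suc (s r))) t"
  by (auto elim: exec_IncE intro: exec.intros)

lemma exec_Loop_0 [simp]: "s r = 0 \<Longrightarrow> exec (Loop r b # k) s t \<longleftrightarrow> exec k s t"
  by (auto elim: exec_LoopE intro: exec.intros)

lemma exec_Loop_Suc_iff:
  "s r = Suc n \<Longrightarrow> exec (Loop r b # k) s t \<longleftrightarrow> exec (b @ Loop r b # k) (s(r := n)) t"
  by (auto elim: exec_LoopE intro: exec.exec_Loop_Suc)

abbreviation clear :: "nat \<Rightarrow> instr list" where "clear r \<equiv> [Loop r []]"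
abbreviation move :: "nat \<Rightarrow> nat \<Rightarrow> instr list" where "move r q \<equiv> [Loop r [Inc q]]"
abbreviation copy :: "nat \<Rightarrow> nat \<Rightarrow> nat \<Rightarrow> instr list" where
  "copy r q h \<equiv> Loop r [Inc q, Inc h] # move h r"
abbreviation diverge :: "nat \<Rightarrow> instr list" where "diverge r \<equiv> [Inc r, Loop r [Inc r]]"

lemma exec_clear: "exec (Loop r [] # k) s t \<longleftrightarrow> exec k (s(r := 0)) t"
proof (induction "s r" arbitrary: s)
  case 0
  then show ?case by (simp add: fun_upd_idem)
next
  case (Suc n)
  then show ?case using Suc.hyps(1)[of "s(r := n)"] by (simp add: exec_Loop_Suc_iff[of s r n])
qed

lemma exec_move:
  "r \<noteq> q \<Longrightarrow> exec (Loop r [Inc q] # k) s t \<longleftrightarrow> exec k (s(q := s q + s r, r := 0)) t"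
proof (induction "s r" arbitrary: s)
  case 0
  then show ?case by (simp add: fun_upd_idem)
next
  case (Suc n)
  then show ?case using Suc.hyps(1)[of "s(r := n, q := Suc (s q))"]
    by (auto simp add: exec_Loop_Suc_iff[of s r n] fun_upd_twist Suc.hyps(2)[symmetric])
qed

lemma exec_Loop_Inc2:
  "distinct [r, q, h] \<Longrightarrow> exec (Loop r [Inc q, Inc h] # k) s t \<longleftrightarrow>
    exec k (s(q := s q + s r, h := s h + s r, r := 0)) t"
proof (induction "s r" arbitrary: s)
  case 0
  then show ?case by (simp add: fun_upd_idem)
next
  case (Suc n)
  then show ?case using Suc.hyps(1)[of "s(r := n, q := Suc (s q), h := Suc (s h))"]
    by (auto simp add: exec_Loop_Suc_iff[of s r n] fun_upd_twist Suc.hyps(2)[symmetric])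
qed

lemma exec_copy:
  assumes "distinct [r, q, h]" "s h = 0"
  shows "exec (copy r q h @ k) s t \<longleftrightarrow> exec k (s(q := s q + s r)) t"
proof -
  have "(s(q := s q + s r, h := s h + s r, r := 0))(r := 0 + (s h + s r), h := 0) = s(q := s q + s r)"
    using assms by (auto simp: fun_eq_iff)
  then show ?thesis using assms by (simp add: exec_Loop_Inc2 exec_move)
qed

lemma not_exec_diverge: "\<not> exec (diverge r) s t"
proof -
  have False if "exec p s t" "p = [Loop r [Inc r]] \<and> s r > 0 \<or> p = [Inc r, Loop r [Inc r]]" for p
    using that by (induction rule: exec.induct) auto
  then show ?thesis by blast
qed

text \<open>
  \<open>compile f as q h\<close> writes the value of \<open>f\<close> at the registers \<open>as\<close> into \<open>q\<close> and works with registers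
  from \<open>h\<close> on.  The arity of \<open>f\<close> is the length of \<open>as\<close>; where \<open>rec_eval\<close> is undefined because the
  arity is wrong, the program diverges.
\<close>

primrec compile :: "recf \<Rightarrow> nat list \<Rightarrow> nat \<Rightarrow> nat \<Rightarrow> instr list" where
  "compile Zero = (\<lambda>as q h. [])"
| "compile Succ = (\<lambda>as q h. if length as = 1 then copy (hd as) q h @ [Inc q] else diverge h)"
| "compile (Proj i) = (\<lambda>as q h. if i < length as then copy (as ! i) q h else diverge h)"
| "compile (Comp f gs) = (\<lambda>as q h. let m = length gs in
     concat (map (\<lambda>(i, c). c as (h + i) (h + m)) (enumerate 0 (map compile gs))) @
     compile f [h..<h + m] q (h + m) @ concat (map clear [h..<h + m]))"
| "compile (PrimRec f g) = (\<lambda>as q h. if as = [] then diverge h else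
     copy (hd as) h (h + 1) @ compile f (tl as) (h + 2) (h + 4) @
     [Loop h (compile g ((h + 2) # (h + 1) # tl as) (h + 3) (h + 4) @
       clear (h + 2) @ move (h + 3) (h + 2) @ [Inc (h + 1)])] @
     move (h + 2) q @ clear (h + 1))"
| "compile (Mu f) = (\<lambda>as q h.
     compile f (h # as) (h + 1) (h + 2) @
     [Loop (h + 1) (clear (h + 1) @ [Inc h] @ compile f (h # as) (h + 1) (h + 2))] @
     move h q)"

text \<open>
  The result is required to be exactly \<open>s(q := y)\<close>: arguments are preserved and the work
  registers are zero again.  Such an equation composes without any bookkeeping of side effects.
\<close>

definition compiles :: "recf \<Rightarrow> bool" where
  "compiles f \<longleftrightarrow> (\<forall>as q h s t. set as \<subseteq> {..<h} \<longrightarrow> q < h \<longrightarrow> q \<notin> set as \<longrightarrow> s q = 0 \<longrightarrow> (\<forall>r\<ge>h. s r = 0) \<longrightarrow>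
     exec (compile f as q h) s t \<longleftrightarrow> (\<exists>y. rec_eval f (map s as) y \<and> t = s(q := y)))"

lemma compilesD:
  "compiles f \<Longrightarrow> set as \<subseteq> {..<h} \<Longrightarrow> q < h \<Longrightarrow> q \<notin> set as \<Longrightarrow> s q = 0 \<Longrightarrow> (\<And>r. r \<ge> h \<Longrightarrow> s r = 0) \<Longrightarrow>
     exec (compile f as q h) s t \<longleftrightarrow> (\<exists>y. rec_eval f (map s as) y \<and> t = s(q := y))"
  unfolding compiles_def by blast

lemma rec_eval_Zero_iff: "rec_eval Zero xs y \<longleftrightarrow> y = 0"
  by (auto elim: rec_eval_ZeroE intro: rec_eval.zero)

lemma rec_eval_Succ_iff: "rec_eval Succ xs y \<longleftrightarrow> (\<exists>x. xs = [x] \<and> y = Suc x)"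
  by (auto elim: rec_eval_SuccE intro: rec_eval.succ)

lemma rec_eval_Proj_iff: "rec_eval (Proj i) xs y \<longleftrightarrow> i < length xs \<and> y = xs ! i"
  by (auto elim: rec_eval_ProjE intro: rec_eval.proj)

lemma rec_eval_Comp_iff: "rec_eval (Comp f gs) xs z \<longleftrightarrow>
    (\<exists>ys. list_all2 (\<lambda>g y. rec_eval g xs y) gs ys \<and> rec_eval f ys z)"
  by (auto elim!: rec_eval_CompE simp: list_all2_conv_all_nth intro: rec_eval.comp) metis

lemma rec_eval_PrimRec_0_iff: "rec_eval (PrimRec f g) (0 # xs) y \<longleftrightarrow> rec_eval f xs y"
  by (auto elim: rec_eval_PrimRec_0E intro: rec_eval.primrec_0)

lemma rec_eval_PrimRec_Suc_iff: "rec_eval (PrimRec f g) (Suc n # xs) z \<longleftrightarrow>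
    (\<exists>y. rec_eval (PrimRec f g) (n # xs) y \<and> rec_eval g (y # n # xs) z)"
  by (auto elim: rec_eval_PrimRec_SucE intro: rec_eval.primrec_Suc)

lemma rec_eval_Mu_iff: "rec_eval (Mu f) xs n \<longleftrightarrow>
    rec_eval f (n # xs) 0 \<and> (\<forall>m<n. \<exists>k. rec_eval f (m # xs) (Suc k))"
  by (auto elim: rec_eval_MuE intro: rec_eval.mu)

lemma not_rec_eval_PrimRec_Nil: "\<not> rec_eval (PrimRec f g) [] y"
  by (auto elim: rec_eval.cases)

lemma compiles_basic: "compiles Zero" "compiles Succ" "compiles (Proj i)"
proof -
  show "compiles Zero" by (auto simp: compiles_def rec_eval_Zero_iff)
  have cp: "exec (copy r q h @ k) s t \<longleftrightarrow> exec k (s(q := s r)) t"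
    if "r < h" "q < h" "q \<noteq> r" "s q = 0" "s h = 0" for r q h k s t
    using that by (subst exec_copy) auto
  show "compiles Succ"
    unfolding compiles_def
  proof (intro allI impI)
    fix as :: "nat list" and q h :: nat and s t :: store
    assume *: "set as \<subseteq> {..<h}" "q < h" "q \<notin> set as" "s q = 0" "\<forall>r\<ge>h. s r = 0"
    show "exec (compile Succ as q h) s t \<longleftrightarrow> (\<exists>y. rec_eval Succ (map s as) y \<and> t = s(q := y))"
    proof (cases "length as = 1")
      case True
      then obtain a where "as = [a]" by (auto simp: length_Suc_conv)
      with * show ?thesis
        using cp[of a h q s "[Inc q]" t] by (auto simp: rec_eval_Succ_iff)
    qed (use not_exec_diverge in \<open>auto simp: rec_eval_Succ_iff\<close>)
  qed
  show "compiles (Proj i)"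
    unfolding compiles_def
  proof (intro allI impI)
    fix as :: "nat list" and q h :: nat and s t :: store
    assume *: "set as \<subseteq> {..<h}" "q < h" "q \<notin> set as" "s q = 0" "\<forall>r\<ge>h. s r = 0"
    show "exec (compile (Proj i) as q h) s t \<longleftrightarrow> (\<exists>y. rec_eval (Proj i) (map s as) y \<and> t = s(q := y))"
    proof (cases "i < length as")
      case True
      then have "as ! i \<in> set as" by simp
      with * have "as ! i < h" "q \<noteq> as ! i" by auto
      with * True show ?thesis
        using cp[of "as ! i" h q s "[]" t] by (auto simp: rec_eval_Proj_iff)
    qed (use not_exec_diverge in \<open>auto simp: rec_eval_Proj_iff\<close>)
  qed
qed

lemma exec_clear_range:
  "exec (concat (map clear [h..<h + m])) s t \<longleftrightarrow> t = (\<lambda>r. if h \<le> r \<and> r < h + m then 0 else s r)"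
proof (induction m arbitrary: t)
  case (Suc m)
  have "(\<lambda>r. if h \<le> r \<and> r < h + m then 0 else s r)(h + m := 0) =
      (\<lambda>r. if h \<le> r \<and> r < h + Suc m then 0 else s r)"
    by (auto simp: fun_eq_iff)
  with Suc show ?case by (simp add: exec_append exec_clear)
qed auto

lemma compiles_Comp:
  assumes f: "compiles f" and gs: "\<And>g. g \<in> set gs \<Longrightarrow> compiles g"
  shows "compiles (Comp f gs)"
  unfolding compiles_def
proof (intro allI impI)
  fix as :: "nat list" and q h :: nat and s t :: store
  assume *: "set as \<subseteq> {..<h}" "q < h" "q \<notin> set as" "s q = 0" "\<forall>r\<ge>h. s r = 0"
  define m where "m = length gs"
  \<comment> \<open>The store after the first arguments have been evaluated to \<open>ys\<close>.\<close>
  define store where "store ys r = (if h \<le> r \<and> r < h + length ys then ys ! (r - h) else s r)" for ys r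
  have args: "exec (concat (map (\<lambda>(i, c). c as (h + i) (h + m)) (enumerate n (map compile gs'))))
      (store ys) u
      \<longleftrightarrow> (\<exists>zs. list_all2 (\<lambda>g y. rec_eval g (map s as) y) gs' zs \<and> u = store (ys @ zs))"
    if "set gs' \<subseteq> set gs" "length ys = n" "n + length gs' = m" for gs' ys n u
    using that
  proof (induction gs' arbitrary: ys n u)
    case Nil
    then show ?case by simp
  next
    case (Cons g gs')
    have ms: "map (store ys) as = map s as"
      using *(1) by (auto simp: store_def)
    have "exec (compile g as (h + n) (h + m)) (store ys) v \<longleftrightarrow>
        (\<exists>y. rec_eval g (map s as) y \<and> v = (store ys)(h + n := y))" for v
      using * Cons.prems unfolding ms[symmetric] by (intro compilesD gs) (auto simp: store_def)
    moreover have "(store ys)(h + n := y) = store (ys @ [y])" for y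
      using Cons.prems(2) by (auto simp: store_def fun_eq_iff nth_append)
    moreover have "exec (concat (map (\<lambda>(i, c). c as (h + i) (h + m)) (enumerate (Suc n) (map compile
        gs'))))
        (store (ys @ [y])) u \<longleftrightarrow> (\<exists>zs. list_all2 (\<lambda>g y. rec_eval g (map s as) y) gs' zs \<and>
            u = store ((ys @ [y]) @ zs))" for y
      using Cons.prems by (intro Cons.IH) auto
    ultimately show ?case
      by (auto simp: exec_append list_all2_Cons1) (metis, blast)
  qed
  have store_Nil: "store [] = s" by (auto simp: store_def)
  have body: "exec (compile f [h..<h + m] q (h + m)) (store ys) u \<longleftrightarrow>
      (\<exists>y. rec_eval f ys y \<and> u = (store ys)(q := y))"
    if "length ys = m" for ys u
  proof -
    have "map (store ys) [h..<h + m] = ys"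
      using that by (intro nth_equalityI) (auto simp: store_def)
    then show ?thesis
      using * that by (subst compilesD[OF f]) (auto simp: store_def cong del: map_cong)
  qed
  have clean: "exec (concat (map clear [h..<h + m])) ((store ys)(q := y)) t \<longleftrightarrow> t = s(q := y)"
    if "length ys = m" for ys y
  proof -
    have "(\<lambda>r. if h \<le> r \<and> r < h + m then 0 else ((store ys)(q := y)) r) = s(q := y)"
      using * that by (auto simp: store_def fun_eq_iff)
    then show ?thesis unfolding exec_clear_range by simp
  qed
  let ?args = "concat (map (\<lambda>(i, c). c as (h + i) (h + m)) (enumerate 0 (map compile gs)))"
  have args': "exec ?args s u \<longleftrightarrow>
      (\<exists>zs. list_all2 (\<lambda>g y. rec_eval g (map s as) y) gs zs \<and> u = store zs)" for u
    using args[of gs "[]" 0 u] by (simp add: store_Nil m_def)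
  have len: "length zs = m" if "list_all2 (\<lambda>g y. rec_eval g (map s as) y) gs zs" for zs
    using list_all2_lengthD[OF that] m_def by simp
  have "compile (Comp f gs) as q h = ?args @ compile f [h..<h + m] q (h + m) @
      concat (map clear [h..<h + m])"
    by (simp add: Let_def m_def)
  then have "exec (compile (Comp f gs) as q h) s t \<longleftrightarrow>
      (\<exists>u. exec ?args s u \<and> (\<exists>v. exec (compile f [h..<h + m] q (h + m)) u v \<and>
        exec (concat (map clear [h..<h + m])) v t))"
    by (simp only: exec_append)
  also have "\<dots> \<longleftrightarrow> (\<exists>zs. list_all2 (\<lambda>g y. rec_eval g (map s as) y) gs zs \<and>
        (\<exists>y. rec_eval f zs y \<and> t = s(q := y)))"
  proof
    assume "\<exists>u. exec ?args s u \<and> (\<exists>v. exec (compile f [h..<h + m] q (h + m)) u v \<and>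
        exec (concat (map clear [h..<h + m])) v t)"
    then obtain zs v where zs: "list_all2 (\<lambda>g y. rec_eval g (map s as) y) gs zs"
        "exec (compile f [h..<h + m] q (h + m)) (store zs) v"
        "exec (concat (map clear [h..<h + m])) v t"
      unfolding args' by blast
    then obtain y where y: "rec_eval f zs y" "v = (store zs)(q := y)"
      using body[OF len] by blast
    with zs clean[OF len[OF zs(1)], of y] show "\<exists>zs. list_all2 (\<lambda>g y. rec_eval g (map s as) y) gs zs \<and>
        (\<exists>y. rec_eval f zs y \<and> t = s(q := y))" by blast
  next
    assume "\<exists>zs. list_all2 (\<lambda>g y. rec_eval g (map s as) y) gs zs \<and>
        (\<exists>y. rec_eval f zs y \<and> t = s(q := y))"
    then obtain zs y where zs: "list_all2 (\<lambda>g y. rec_eval g (map s as) y) gs zs"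
        "rec_eval f zs y" "t = s(q := y)"
      by blast
    then show "\<exists>u. exec ?args s u \<and> (\<exists>v. exec (compile f [h..<h + m] q (h + m)) u v \<and>
        exec (concat (map clear [h..<h + m])) v t)"
      using args' body[OF len[OF zs(1)]] clean[OF len[OF zs(1)], of y] by blast
  qed
  also have "\<dots> \<longleftrightarrow> (\<exists>y. rec_eval (Comp f gs) (map s as) y \<and> t = s(q := y))"
    unfolding rec_eval_Comp_iff by blast
  finally show "exec (compile (Comp f gs) as q h) s t \<longleftrightarrow> \<dots>" .
qed

text \<open>
  Induction over the iterations of a loop, for which the rule induction of \<open>exec\<close> is too fine: the
  latter also stops at every instruction inside the body.
\<close>

lemma exec_Loop_induct:
  assumes "exec (Loop r b # k) s t"
    and zero: "\<And>s. s r = 0 \<Longrightarrow> exec k s t \<Longrightarrow> P s"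
    and Suc: "\<And>s n u. s r = Suc n \<Longrightarrow> exec b (s(r := n)) u \<Longrightarrow> P u \<Longrightarrow> P s"
  shows "P s"
proof -
  have "exec pq s t' \<Longrightarrow> t' = t \<Longrightarrow> pq = p @ Loop r b # k \<Longrightarrow> \<exists>u. exec p s u \<and> P u" for pq p t'
  proof (induction arbitrary: p rule: exec.induct)
    case (exec_Nil s)
    then show ?case by simp
  next
    case (exec_Inc k' s r' t')
    then obtain p' where "p = Inc r' # p'" "k' = p' @ Loop r b # k" by (cases p) auto
    with exec_Inc show ?case by (simp add: fun_upd_def)
  next
    case (exec_Loop_zero s r' k' t' b')
    show ?case
    proof (cases p)
      case Nil
      then show ?thesis using exec_Loop_zero zero by auto
    next
      case (Cons i p')
      then show ?thesis using exec_Loop_zero by auto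
    qed
  next
    case (exec_Loop_Suc s r' n b' k' t')
    show ?case
    proof (cases p)
      case Nil
      then have [simp]: "r' = r" "b' = b" "k' = k" using exec_Loop_Suc.prems by auto
      have "b' @ Loop r' b' # k' = b @ Loop r b # k" by simp
      from exec_Loop_Suc.IH[OF exec_Loop_Suc.prems(1) this]
      obtain u where "exec b (s(r' := n)) u" "P u" by blast
      then show ?thesis using Nil Suc[of s n u] exec_Loop_Suc.hyps by simp
    next
      case (Cons i p')
      then have eq: "b' @ Loop r' b' # k' = (b' @ Loop r' b' # p') @ Loop r b # k" "i = Loop r' b'"
        using exec_Loop_Suc.prems by auto
      obtain u where "exec (b' @ Loop r' b' # p') (s(r' := n)) u" "P u"
        using exec_Loop_Suc.IH[OF exec_Loop_Suc.prems(1) eq(1)] by blast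
      then show ?thesis
        using exec_Loop_Suc.hyps Cons eq(2) by (blast intro: exec.exec_Loop_Suc)
    qed
  qed
  from this[OF assms(1) refl, of "[]"] show ?thesis by simp
qed

lemma rec_eval_PrimRec_down:
  "rec_eval (PrimRec f g) ((i + k) # xs) y \<Longrightarrow> \<exists>z. rec_eval (PrimRec f g) (i # xs) z"
proof (induction k arbitrary: y)
  case (Suc k)
  then show ?case by (auto simp: rec_eval_PrimRec_Suc_iff)
qed auto

lemma compiles_PrimRec:
  assumes f: "compiles f" and g: "compiles g"
  shows "compiles (PrimRec f g)"
  unfolding compiles_def
proof (intro allI impI)
  fix as :: "nat list" and q h :: nat and s t :: store
  assume *: "set as \<subseteq> {..<h}" "q < h" "q \<notin> set as" "s q = 0" "\<forall>r\<ge>h. s r = 0"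
  let ?P = "PrimRec f g"
  show "exec (compile ?P as q h) s t \<longleftrightarrow> (\<exists>y. rec_eval ?P (map s as) y \<and> t = s(q := y))"
  proof (cases as)
    case Nil
    then show ?thesis using not_exec_diverge by (simp add: not_rec_eval_PrimRec_Nil)
  next
    case (Cons a as')
    define xs where "xs = map s as'"
    \<comment> \<open>Remaining rounds, index and accumulator; the body uses \<open>h + 3\<close> for the next value.\<close>
    define S where "S i m acc = s(h := m, h + 1 := i, h + 2 := acc)" for i m acc :: nat
    define body where "body = compile g ((h + 2) # (h + 1) # as') (h + 3) (h + 4) @
       clear (h + 2) @ move (h + 3) (h + 2) @ [Inc (h + 1)]"
    have xs: "map (S i m acc) as' = xs" for i m acc
      using * Cons by (auto simp: S_def xs_def)
    have body: "exec (body @ k) (S i m acc) u \<longleftrightarrow>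
        (\<exists>y. rec_eval g (acc # i # xs) y \<and> exec k (S (Suc i) m y) u)" for i m acc u k
    proof -
      have "set as' \<subseteq> {..<h + 4}" "h + 3 \<notin> set as'" using * Cons by auto
      then have "exec (compile g ((h + 2) # (h + 1) # as') (h + 3) (h + 4)) (S i m acc) v \<longleftrightarrow>
          (\<exists>y. rec_eval g (acc # i # xs) y \<and> v = (S i m acc)(h + 3 := y))" for v
        using compilesD[OF g, of "(h + 2) # (h + 1) # as'" "h + 4" "h + 3" "S i m acc" v] * Cons
        by (simp add: xs) (auto simp: S_def)
      moreover have "exec ((clear (h + 2) @ move (h + 3) (h + 2) @ [Inc (h + 1)]) @
          k) ((S i m acc)(h + 3 := y)) u
          \<longleftrightarrow> exec k (S (Suc i) m y) u" for y
      proof -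
        have "((S i m acc)(h + 3 := y, h + 2 := 0))(h + 2 := y, h + 3 := 0, h + 1 := Suc i) = S (Suc
            i) m y"
          using * by (auto simp: S_def fun_eq_iff)
        then show ?thesis by (simp add: exec_clear exec_move) (simp add: S_def)
      qed
      ultimately show ?thesis
        unfolding body_def append_assoc exec_append[of "compile g _ _ _"] by auto
    qed
    have loop: "exec (Loop h body # k) (S i m acc) u \<longleftrightarrow>
        (\<exists>y. rec_eval ?P ((i + m) # xs) y \<and> exec k (S (i + m) 0 y) u)"
      if "rec_eval ?P (i # xs) acc" for i m acc u k
      using that
    proof (induction m arbitrary: i acc)
      case 0
      moreover have "S i 0 acc h = 0" by (simp add: S_def)
      ultimately show ?case using rec_eval_deterministic by auto
    next
      case (Suc m)
      have "(S i (Suc m) acc)(h := m) = S i m acc" "S i (Suc m) acc h = Suc m"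
        by (auto simp: S_def fun_eq_iff)
      then have "exec (Loop h body # k) (S i (Suc m) acc) u \<longleftrightarrow>
          (\<exists>y. rec_eval g (acc # i # xs) y \<and> exec (Loop h body # k) (S (Suc i) m y) u)"
        using body by (simp add: exec_Loop_Suc_iff)
      also have "\<dots> \<longleftrightarrow> (\<exists>y. rec_eval ?P (Suc i # xs) y \<and> exec (Loop h body # k) (S (Suc i) m y) u)"
        using Suc.prems rec_eval_deterministic unfolding rec_eval_PrimRec_Suc_iff by blast
      also have "\<dots> \<longleftrightarrow> (\<exists>y. rec_eval ?P ((i + Suc m) # xs) y \<and> exec k (S (i + Suc m) 0 y) u)"
        using Suc.IH[of "Suc i"] rec_eval_PrimRec_down[of f g "Suc i" m xs] by auto blast
      finally show ?case .
    qed
    have init: "exec (compile f as' (h + 2) (h + 4)) (s(h := s a)) u \<longleftrightarrow>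
        (\<exists>y. rec_eval f xs y \<and> u = S 0 (s a) y)" for u
    proof -
      have "map (s(h := s a)) as' = xs" using * Cons by (auto simp: xs_def)
      moreover have "(s(h := s a))(h + 2 := y) = S 0 (s a) y" for y
        using * by (auto simp: S_def fun_eq_iff)
      moreover have "set as' \<subseteq> {..<h + 4}" "h + 2 \<notin> set as'" using * Cons by auto
      ultimately show ?thesis
        using compilesD[OF f, of as' "h + 4" "h + 2" "s(h := s a)" u] * Cons by auto
    qed
    have fetch: "exec (copy a h (h + 1) @ k) s t \<longleftrightarrow> exec k (s(h := s a)) t" for k
      using * Cons by (subst exec_copy) auto
    have final: "exec (move (h + 2) q @ clear (h + 1)) (S n 0 y) t \<longleftrightarrow> t = s(q := y)" for n y
    proof -
      have "((S n 0 y)(q := y, h + 2 := 0))(h + 1 := 0) = s(q := y)"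
        using * by (auto simp: S_def fun_eq_iff)
      then show ?thesis using * by (simp add: exec_move exec_clear) (simp add: S_def)
    qed
    let ?loop = "Loop h body # move (h + 2) q @ clear (h + 1)"
    have "compile ?P as q h = copy a h (h + 1) @ compile f as' (h + 2) (h + 4) @ ?loop"
      by (simp add: Cons body_def)
    then have "exec (compile ?P as q h) s t \<longleftrightarrow>
        (\<exists>u. exec (compile f as' (h + 2) (h + 4)) (s(h := s a)) u \<and> exec ?loop u t)"
      by (simp only: fetch exec_append[of "compile f _ _ _"])
    also have "\<dots> \<longleftrightarrow> (\<exists>y0. rec_eval f xs y0 \<and> exec ?loop (S 0 (s a) y0) t)"
      unfolding init by blast
    also have "\<dots> \<longleftrightarrow> (\<exists>y0. rec_eval f xs y0 \<and> (\<exists>y. rec_eval ?P (s a # xs) y \<and> t = s(q := y)))"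
      by (intro ex_cong conj_cong refl) (simp only: loop rec_eval_PrimRec_0_iff final add_0)
    also have "\<dots> \<longleftrightarrow> (\<exists>y. rec_eval ?P (map s as) y \<and> t = s(q := y))"
      using Cons rec_eval_PrimRec_down[of f g 0 "s a" xs]
          by (auto simp: xs_def rec_eval_PrimRec_0_iff)
    finally show ?thesis .
  qed
qed

lemma compiles_Mu:
  assumes f: "compiles f"
  shows "compiles (Mu f)"
  unfolding compiles_def
proof (intro allI impI)
  fix as :: "nat list" and q h :: nat and s t :: store
  assume *: "set as \<subseteq> {..<h}" "q < h" "q \<notin> set as" "s q = 0" "\<forall>r\<ge>h. s r = 0"
  define xs where "xs = map s as"
  \<comment> \<open>The current candidate and the value of \<open>f\<close> at it.\<close>
  define S where "S i v = s(h := i, h + 1 := v)" for i v :: nat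
  define body where "body = clear (h + 1) @ [Inc h] @ compile f (h # as) (h + 1) (h + 2)"
  have eval: "exec (compile f (h # as) (h + 1) (h + 2)) (S i 0) u \<longleftrightarrow>
      (\<exists>v. rec_eval f (i # xs) v \<and> u = S i v)" for i u
  proof -
    have S: "S i 0 r = 0" if "r > h" for r using * that by (simp add: S_def)
    have side: "set as \<subseteq> {..<h + 2}" "h + 1 \<notin> set as" using * by auto
    have "map (S i 0) (h # as) = i # xs" "(S i 0)(h + 1 := v) = S i v" for v
      using * by (auto simp: xs_def S_def)
    moreover have "S i 0 r = 0" if "r > h" for r
      using * that by (auto simp: S_def)
    ultimately show ?thesis
      using side compilesD[OF f, of "h # as" "h + 2" "h + 1" "S i 0" u] by simp
  qed
  have body: "exec body (S i k) u \<longleftrightarrow> (\<exists>v. rec_eval f (Suc i # xs) v \<and> u = S (Suc i) v)" for i k u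
  proof -
    have "((S i k)(h + 1 := 0))(h := Suc i) = S (Suc i) 0" by (auto simp: S_def fun_eq_iff)
    moreover have "S i k h = i" by (simp add: S_def)
    ultimately show ?thesis using eval[of "Suc i" u] by (simp add: body_def exec_clear)
  qed
  have test: "S i v (h + 1) = v" and dec: "(S i v)(h + 1 := k) = S i k" for i v k
    by (auto simp: S_def)
  have final: "exec (move h q) (S i 0) t \<longleftrightarrow> t = s(q := i)" for i
  proof -
    have "(S i 0)(q := i, h := 0) = s(q := i)" using * by (auto simp: S_def fun_eq_iff)
    then show ?thesis using * by (simp add: exec_move) (simp add: S_def)
  qed
  let ?loop = "Loop (h + 1) body # move h q"
  have loop_sound: "\<exists>n. rec_eval (Mu f) xs n \<and> t = s(q := n)"
    if "exec ?loop (S i v) t" "rec_eval f (i # xs) v" "\<forall>m<i. \<exists>k. rec_eval f (m # xs) (Suc k)" for i v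
  proof -
    have "\<forall>i v. u = S i v \<longrightarrow> rec_eval f (i # xs) v \<longrightarrow> (\<forall>m<i. \<exists>k. rec_eval f (m # xs) (Suc k)) \<longrightarrow>
        (\<exists>n. rec_eval (Mu f) xs n \<and> t = s(q := n))" if "exec ?loop u t" for u
      using that
    proof (rule exec_Loop_induct; intro allI impI)
      fix u i v assume "u (h + 1) = 0" "exec (move h q) u t" "u = S i v" "rec_eval f (i # xs) v"
        "\<forall>m<i. \<exists>k. rec_eval f (m # xs) (Suc k)"
      moreover from this have "v = 0" using test by simp
      ultimately show "\<exists>n. rec_eval (Mu f) xs n \<and> t = s(q := n)"
        using final by (auto simp: rec_eval_Mu_iff)
    next
      fix u n u' i v
      assume u: "u (h + 1) = Suc n" "exec body (u(h + 1 := n)) u'" "u = S i v" "rec_eval f (i # xs) v"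
        "\<forall>m<i. \<exists>k. rec_eval f (m # xs) (Suc k)"
        and IH: "\<forall>i v. u' = S i v \<longrightarrow> rec_eval f (i # xs) v \<longrightarrow> (\<forall>m<i. \<exists>k. rec_eval f (m # xs) (Suc k)) \<longrightarrow>
          (\<exists>n. rec_eval (Mu f) xs n \<and> t = s(q := n))"
      have v: "v = Suc n" using u test by simp
      obtain v' where "rec_eval f (Suc i # xs) v'" "u' = S (Suc i) v'"
        using u(2) unfolding u(3) dec body by blast
      moreover have "\<forall>m<Suc i. \<exists>k. rec_eval f (m # xs) (Suc k)"
        using u(4,5) v by (auto simp: less_Suc_eq)
      ultimately show "\<exists>n. rec_eval (Mu f) xs n \<and> t = s(q := n)" using IH by blast
    qed
    with that show ?thesis by blast
  qed
  have loop_complete: "exec ?loop (S i v) t"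
    if n: "rec_eval (Mu f) xs n" and "i \<le> n" "rec_eval f (i # xs) v" and t: "t = s(q := n)" for i v n
    using that(2,3)
  proof (induction i arbitrary: v rule: inc_induct)
    case base
    then have "v = 0" using n rec_eval_deterministic unfolding rec_eval_Mu_iff by blast
    moreover have "exec (move h q) (S n 0) t" using final t by blast
    ultimately show ?case
        using exec_Loop_0[of "S n 0" "h + 1" body "move h q" t] test \<open>v = 0\<close> by metis
  next
    case (step i)
    obtain k where "rec_eval f (i # xs) (Suc k)" using n step(2) unfolding rec_eval_Mu_iff by blast
    then have v: "v = Suc k" using step.prems rec_eval_deterministic by blast
    obtain v' where v': "rec_eval f (Suc i # xs) v'"
    proof (cases "Suc i = n")
      case True
      then show ?thesis using n that unfolding rec_eval_Mu_iff by blast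
    next
      case False
      then have "Suc i < n" using step(2) by simp
      then show ?thesis using n that unfolding rec_eval_Mu_iff by blast
    qed
    then have "exec body (S i k) (S (Suc i) v')" using body by blast
    then have "exec (body @ ?loop) (S i k) t"
      using step.IH[OF v'] exec_append by blast
    then show ?case
      using exec_Loop_Suc_iff[of "S i (Suc k)" "h + 1" k body "move h q" t] test[of i "Suc k"]
      by (simp add: v dec[of i "Suc k" k, simplified])
  qed
  have "S 0 0 = s" using * by (auto simp: S_def fun_eq_iff)
  moreover have "compile (Mu f) as q h = compile f (h # as) (h + 1) (h + 2) @ ?loop"
    by (simp add: body_def)
  ultimately have "exec (compile (Mu f) as q h) s t \<longleftrightarrow>
      (\<exists>v. rec_eval f (0 # xs) v \<and> exec ?loop (S 0 v) t)"
    using eval[of 0] by (simp only: exec_append) blast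
  also have "\<dots> \<longleftrightarrow> (\<exists>y. rec_eval (Mu f) (map s as) y \<and> t = s(q := y))"
  proof
    assume "\<exists>v. rec_eval f (0 # xs) v \<and> exec ?loop (S 0 v) t"
    then show "\<exists>y. rec_eval (Mu f) (map s as) y \<and> t = s(q := y)"
      using loop_sound[of 0] by (auto simp: xs_def)
  next
    assume "\<exists>y. rec_eval (Mu f) (map s as) y \<and> t = s(q := y)"
    then obtain n where n: "rec_eval (Mu f) xs n" "t = s(q := n)" by (auto simp: xs_def)
    then obtain v where "rec_eval f (0 # xs) v" unfolding rec_eval_Mu_iff by (cases n) blast+
    then show "\<exists>v. rec_eval f (0 # xs) v \<and> exec ?loop (S 0 v) t"
      using loop_complete n by blast
  qed
  finally show "exec (compile (Mu f) as q h) s t \<longleftrightarrow> \<dots>" .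
qed

theorem compiles_recf: "compiles f"
proof (induction f)
  case (Comp f gs)
  then show ?case by (intro compiles_Comp) auto
qed (simp_all add: compiles_basic compiles_PrimRec compiles_Mu)

text \<open>
  All registers are cleared at the end, so that halting means reaching one single final
  configuration.
\<close>

definition halting_program :: "recf \<Rightarrow> instr list" where
  "halting_program f = compile f [0] 1 2 @ clear 0 @ clear 1"

lemma exec_halting_program:
  "exec (halting_program f) ((\<lambda>_. 0)(0 := x)) (\<lambda>_. 0) \<longleftrightarrow> (\<exists>y. rec_eval f [x] y)"
proof -
  let ?s = "(\<lambda>_. 0)(0 := x) :: store"
  have "exec (clear 0 @ clear 1) (?s(1 := y)) (\<lambda>_. 0)" for y
  proof -
    have "(?s(1 := y))(0 := 0, 1 := 0) = (\<lambda>_. 0)" by (auto simp: fun_eq_iff)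
    then show ?thesis by (simp add: exec_clear del: fun_upd_apply)
  qed
  moreover have "exec (compile f [0] 1 2) ?s u \<longleftrightarrow> (\<exists>y. rec_eval f [x] y \<and> u = ?s(1 := y))" for u
    using compilesD[OF compiles_recf, of "[0]" 2 1 ?s f u] by simp
  ultimately show ?thesis
    unfolding halting_program_def exec_append[of "compile f _ _ _"] by blast
qed

section \<open>Programs as queue systems\<close>

text \<open>
  A pair \<open>(u, v)\<close> is read as the rule that removes \<open>u\<close> from the front of a queue and appends \<open>v\<close> at
  its end.  If no \<open>u\<close> is longer than the queue it is applied to, the equation says exactly that some
  sequence of rules transforms \<open>w\<close> into \<open>f\<close>; on the other hand it is Post's equation with prescribed
  ends.
\<close>

definition queue_solvable :: "('a list \<times> 'a list) set \<Rightarrow> 'a list \<Rightarrow> 'a list \<Rightarrow> bool" where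
  "queue_solvable R w f \<longleftrightarrow>
     (\<exists>qs. set qs \<subseteq> R \<and> w @ concat (map snd qs) = concat (map fst qs) @ f)"

lemma queue_solvable_Nil: "queue_solvable R f f"
  unfolding queue_solvable_def by (intro exI[of _ "[]"]) simp

lemma queue_solvable_step:
  assumes "(u, v) \<in> R" "queue_solvable R (w @ v) f"
  shows "queue_solvable R (u @ w) f"
proof -
  obtain qs where "set qs \<subseteq> R" "(w @ v) @ concat (map snd qs) = concat (map fst qs) @ f"
    using assms(2) unfolding queue_solvable_def by blast
  with assms(1) show ?thesis
    unfolding queue_solvable_def by (intro exI[of _ "(u, v) # qs"]) simp
qed

text \<open>
  A configuration consists of a remaining program \<open>k\<close> and a store.  It is written as a cyclic word
  with \<open>s r\<close> copies of \<open>Unit r\<close>, one \<open>Mark\<close>, and one head \<open>Run k\<close>.  During the zero test of a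
  loop the head is \<open>Test k\<close>.
\<close>

datatype letter = Unit nat | Mark | Run "instr list" | Test "instr list"

abbreviation plain :: "nat set \<Rightarrow> letter set" where "plain C \<equiv> insert Mark (Unit ` C)"

text \<open>
  Copying rotates the cyclic word past the front of the queue, and moving lets the head travel, so
  the order of the units is irrelevant.  An increment adds a unit and a loop iteration removes the
  unit next to the head.  To leave the loop on \<open>r\<close>, the head turns into \<open>Test\<close> just after passing
  \<open>Mark\<close>; then it cannot pass a \<open>Unit r\<close>, and it turns back only at \<open>Mark\<close>, having gone
  all the way round.  Wrong guesses get stuck or change nothing.
\<close>

inductive_set queue_rules :: "nat set \<Rightarrow> instr list set \<Rightarrow> (letter list \<times> letter list) set" for C K
    where
  rule_copy: "c \<in> plain C \<Longrightarrow> ([c], [c]) \<in> queue_rules C K"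
| rule_move: "c \<in> plain C \<Longrightarrow> k \<in> K \<Longrightarrow> ([Run k, c], [c, Run k]) \<in> queue_rules C K"
| rule_Inc: "Inc r # k \<in> K \<Longrightarrow> ([Run (Inc r # k)], [Run k, Unit r]) \<in> queue_rules C K"
| rule_dec: "Loop r b # k \<in> K \<Longrightarrow>
    ([Run (Loop r b # k), Unit r], [Run (b @ Loop r b # k)]) \<in> queue_rules C K"
| rule_test: "Loop r b # k \<in> K \<Longrightarrow>
    ([Run (Loop r b # k), Mark], [Mark, Test (Loop r b # k)]) \<in> queue_rules C K"
| rule_skip: "Loop r b # k \<in> K \<Longrightarrow> j \<in> C \<Longrightarrow> j \<noteq> r \<Longrightarrow>
    ([Test (Loop r b # k), Unit j], [Unit j, Test (Loop r b # k)]) \<in> queue_rules C K"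
| rule_exit: "Loop r b # k \<in> K \<Longrightarrow>
    ([Test (Loop r b # k), Mark], [Run k, Mark]) \<in> queue_rules C K"

lemma finite_queue_rules:
  assumes "finite C" "finite K"
  shows "finite (queue_rules C K)"
proof -
  have "queue_rules C K \<subseteq>
      (\<lambda>c. ([c], [c])) ` plain C \<union>
      (\<lambda>(k, c). ([Run k, c], [c, Run k])) ` (K \<times> plain C) \<union>
      (\<lambda>k. case k of Inc r # k' \<Rightarrow> ([Run k], [Run k', Unit r])) ` K \<union>
      (\<lambda>k. case k of Loop r b # k' \<Rightarrow> ([Run k, Unit r], [Run (b @ k)])) ` K \<union>
      (\<lambda>k. ([Run k, Mark], [Mark, Test k])) ` K \<union>
      (\<lambda>(k, j). ([Test k, Unit j], [Unit j, Test k])) ` (K \<times> C) \<union>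
      (\<lambda>k. case k of _ # k' \<Rightarrow> ([Test k, Mark], [Run k', Mark])) ` K"
    (is "_ \<subseteq> ?A1 \<union> ?A2 \<union> ?A3 \<union> ?A4 \<union> ?A5 \<union> ?A6 \<union> ?A7")
  proof (rule subrelI)
    fix u v assume "(u, v) \<in> queue_rules C K"
    then have "(u, v) \<in> ?A1 \<or> (u, v) \<in> ?A2 \<or> (u, v) \<in> ?A3 \<or> (u, v) \<in> ?A4 \<or> (u, v) \<in> ?A5 \<or> (u, v) \<in>
        ?A6 \<or> (u, v) \<in> ?A7"
    proof cases
      case (rule_copy c)
      then have "(u, v) \<in> ?A1" by (intro image_eqI[of _ _ c]) simp_all
      then show ?thesis by simp
    next
      case (rule_move c k)
      then have "(u, v) \<in> ?A2" by (intro image_eqI[of _ _ "(k, c)"]) simp_all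
      then show ?thesis by simp
    next
      case (rule_Inc r k)
      then have "(u, v) \<in> ?A3" by (intro image_eqI[of _ _ "Inc r # k"]) simp_all
      then show ?thesis by simp
    next
      case (rule_dec r b k)
      then have "(u, v) \<in> ?A4" by (intro image_eqI[of _ _ "Loop r b # k"]) simp_all
      then show ?thesis by simp
    next
      case (rule_test r b k)
      then have "(u, v) \<in> ?A5" by (intro image_eqI[of _ _ "Loop r b # k"]) simp_all
      then show ?thesis by simp
    next
      case (rule_skip r b k j)
      then have "(u, v) \<in> ?A6" by (intro image_eqI[of _ _ "(Loop r b # k, j)"]) simp_all
      then show ?thesis by simp
    next
      case (rule_exit r b k)
      then have "(u, v) \<in> ?A7" by (intro image_eqI[of _ _ "Loop r b # k"]) simp_all
      then show ?thesis by simp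
    qed
    then show "(u, v) \<in> ?A1 \<union> ?A2 \<union> ?A3 \<union> ?A4 \<union> ?A5 \<union> ?A6 \<union> ?A7"
      by simp
  qed
  then show ?thesis by (rule finite_subset) (use assms in auto)
qed

lemma queue_rules_nonempty: "(u, v) \<in> queue_rules C K \<Longrightarrow> u \<noteq> [] \<and> v \<noteq> []"
  by (auto elim: queue_rules.cases)

text \<open>
  The equation for \<open>s\<close> is oriented so as to rewrite the store to counts of letters.
\<close>

definition represents :: "letter list \<Rightarrow> store \<Rightarrow> bool" where
  "represents w s \<longleftrightarrow> set w \<subseteq> range Unit \<union> {Mark} \<and> count_list w Mark = 1 \<and>
      (\<forall>r. s r = count_list w (Unit r))"

lemma count_list_Cons: "count_list (x # xs) y = of_bool (x = y) + count_list xs y"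
  by simp

(* of_bool keeps sums of counts linear, where the recursive equation would split into cases. *)
declare count_list.simps(2) [simp del] count_list_Cons [simp]

lemma represents_Mark:
  assumes "represents w s"
  obtains w1 w2 where "w = w1 @ Mark # w2" "Mark \<notin> set w1 \<union> set w2"
proof -
  have "Mark \<in> set w" using assms unfolding represents_def by (metis count_notin zero_neq_one)
  then obtain w1 w2 where w: "w = w1 @ Mark # w2" by (meson split_list)
  moreover have "Mark \<notin> set w1 \<union> set w2"
    using assms w by (auto simp: represents_def count_list_0_iff)
  ultimately show ?thesis using that by blast
qed

lemma represents_Unit_iff: "represents w s \<Longrightarrow> Unit r \<in> set w \<longleftrightarrow> s r \<noteq> 0"
  unfolding represents_def by (metis count_list_0_iff)

text \<open>
  Completeness: each step of a run is imitated by rules, where the finite sets \<open>C\<close> of registers and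
  \<open>K\<close> of remaining programs have to be closed under the steps.  Proofs go backwards from the
  final word, as \<open>queue_solvable_step\<close> does.
\<close>

context
  fixes C :: "nat set" and K :: "instr list set" and R
  assumes K: "\<And>r k. Inc r # k \<in> K \<Longrightarrow> k \<in> K \<and> r \<in> C"
    "\<And>r b k. Loop r b # k \<in> K \<Longrightarrow> k \<in> K \<and> b @ Loop r b # k \<in> K"
  defines "R \<equiv> queue_rules C K"
begin

lemma queue_rotate:
  assumes "set w \<subseteq> plain C" "queue_solvable R (v @ w) f"
  shows "queue_solvable R (w @ v) f"
  using assms
proof (induction w arbitrary: v)
  case (Cons c w)
  then have "queue_solvable R (w @ (v @ [c])) f" by (intro Cons.IH) auto
  then show ?case
    using queue_solvable_step[of "[c]" "[c]" R "w @ v" f] Cons.prems rule_copy unfolding R_def by auto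
qed simp

text \<open>
  Moving the head over \<open>v\<close> and copying the remaining letters has the effect of rotating the rest of
  the word under a head that stays at the front.
\<close>

lemma queue_Run_rotate:
  assumes "k \<in> K" "set (v @ w) \<subseteq> plain C" "queue_solvable R (Run k # w @ v) f"
  shows "queue_solvable R (Run k # v @ w) f"
  using assms(2-)
proof (induction v arbitrary: w)
  case (Cons c v)
  then have "queue_solvable R (Run k # v @ w @ [c]) f" by (intro Cons.IH) auto
  then have "queue_solvable R ((v @ w) @ [c, Run k]) f"
    using queue_rotate[of "v @ w @ [c]" "[Run k]"] Cons.prems by auto
  then show ?case
    using queue_solvable_step[of "[Run k, c]" "[c, Run k]" R "v @ w"] Cons.prems rule_move assms(1)
    unfolding R_def by auto
qed simp

lemma queue_Test_move:
  assumes k: "Loop r b # k \<in> K" and "set (v @ w) \<subseteq> plain C" "set v \<subseteq> Unit ` (C - {r})"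
    and "queue_solvable R (Test (Loop r b # k) # w @ v) f"
  shows "queue_solvable R (Test (Loop r b # k) # v @ w) f"
  using assms(2-)
proof (induction v arbitrary: w)
  case (Cons c v)
  then have "queue_solvable R (Test (Loop r b # k) # v @ w @ [c]) f" by (intro Cons.IH) auto
  then have *: "queue_solvable R ((v @ w) @ [c, Test (Loop r b # k)]) f"
    using queue_rotate[of "v @ w @ [c]" "[Test (Loop r b # k)]"] Cons.prems by auto
  obtain j where "c = Unit j" "j \<in> C" "j \<noteq> r" using Cons.prems by auto
  with * show ?case
    using queue_solvable_step[of "[Test (Loop r b # k), c]" "[c, Test (Loop r b # k)]" R "v @ w"]
      rule_skip[OF k] unfolding R_def by auto
qed simp

lemma queue_complete:
  assumes "exec k s t" "t = (\<lambda>_. 0)" "k \<in> K" "set w \<subseteq> plain C" "represents w s"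
  shows "queue_solvable R (Run k # w) [Run [], Mark]"
  using assms
proof (induction arbitrary: w rule: exec.induct)
  case (exec_Nil s)
  obtain w1 w2 where w: "w = w1 @ Mark # w2" "Mark \<notin> set w1 \<union> set w2"
    using exec_Nil.prems represents_Mark by blast
  have "x \<notin> set w1 \<union> set w2" for x
    using exec_Nil.prems w represents_Unit_iff[of w s] by (cases x) auto
  then have "w1 = []" "w2 = []" by (meson UnI1 UnI2 list.set_sel(1))+
  then have "w = [Mark]" using w by simp
  then show ?case using queue_solvable_Nil by simp
next
  case (exec_Inc k s r t)
  have k: "k \<in> K" "r \<in> C" using K(1)[OF exec_Inc.prems(2)] by simp_all
  have "queue_solvable R (Run k # Unit r # w) [Run [], Mark]"
    using exec_Inc.prems k by (intro exec_Inc.IH) (auto simp: represents_def)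
  then have "queue_solvable R (w @ [Run k, Unit r]) [Run [], Mark]"
    using exec_Inc.prems queue_rotate[of w "[Run k, Unit r]"] by simp
  then show ?case
    using queue_solvable_step[of "[Run (Inc r # k)]" "[Run k, Unit r]" R w] rule_Inc[OF
        exec_Inc.prems(2)]
    unfolding R_def by auto
next
  case (exec_Loop_zero s r k t b)
  let ?k = "Loop r b # k"
  have k: "k \<in> K" using K(2)[OF exec_Loop_zero.prems(2)] by simp
  obtain w1 w2 where w: "w = w1 @ Mark # w2" "Mark \<notin> set w1 \<union> set w2"
    using exec_Loop_zero.prems represents_Mark by blast
  have "Unit r \<notin> set w" using exec_Loop_zero.prems exec_Loop_zero.hyps represents_Unit_iff by blast
  then have sub: "set w1 \<subseteq> Unit ` (C - {r})" "set w2 \<subseteq> Unit ` (C - {r})"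
    using exec_Loop_zero.prems w by auto
  let ?w = "w2 @ w1"
  have "queue_solvable R (Run k # Mark # ?w) [Run [], Mark]"
    using exec_Loop_zero.prems k w by (intro exec_Loop_zero.IH) (auto simp: represents_def)
  then have "queue_solvable R (?w @ [Run k, Mark]) [Run [], Mark]"
    using exec_Loop_zero.prems w queue_rotate[of ?w "[Run k, Mark]"] by auto
  then have "queue_solvable R (Test ?k # [Mark] @ ?w) [Run [], Mark]"
    using queue_solvable_step[of "[Test ?k, Mark]" "[Run k, Mark]" R ?w] rule_exit[OF
        exec_Loop_zero.prems(2)]
    unfolding R_def by auto
  then have "queue_solvable R (Test ?k # ?w @ [Mark]) [Run [], Mark]"
    using exec_Loop_zero.prems w sub queue_Test_move[OF exec_Loop_zero.prems(2), of ?w "[Mark]"]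
        by auto
  then have "queue_solvable R (?w @ [Mark, Test ?k]) [Run [], Mark]"
    using exec_Loop_zero.prems w queue_rotate[of "?w @ [Mark]" "[Test ?k]"] by auto
  then have "queue_solvable R (Run ?k # (Mark # w2) @ w1) [Run [], Mark]"
    using queue_solvable_step[of "[Run ?k, Mark]" "[Mark, Test ?k]" R ?w] rule_test[OF
        exec_Loop_zero.prems(2)]
    unfolding R_def by auto
  then show ?case
    using exec_Loop_zero.prems w queue_Run_rotate[of ?k w1 "Mark # w2"] by auto
next
  case (exec_Loop_Suc s r n b k t)
  let ?k = "Loop r b # k"
  have k: "b @ ?k \<in> K" using K(2)[OF exec_Loop_Suc.prems(2)] by simp
  have "Unit r \<in> set w" using exec_Loop_Suc.prems exec_Loop_Suc.hyps represents_Unit_iff by simp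
  then obtain w1 w2 where w: "w = w1 @ Unit r # w2" by (meson split_list)
  let ?w = "w2 @ w1"
  have "queue_solvable R (Run (b @ ?k) # ?w) [Run [], Mark]"
    using exec_Loop_Suc.prems exec_Loop_Suc.hyps k w
        by (intro exec_Loop_Suc.IH) (auto simp: represents_def)
  then have "queue_solvable R (?w @ [Run (b @ ?k)]) [Run [], Mark]"
    using exec_Loop_Suc.prems w queue_rotate[of ?w "[Run (b @ ?k)]"] by auto
  then have "queue_solvable R (Run ?k # (Unit r # w2) @ w1) [Run [], Mark]"
    using queue_solvable_step[of "[Run ?k, Unit r]" "[Run (b @
        ?k)]" R ?w] rule_dec[OF exec_Loop_Suc.prems(2)]
    unfolding R_def by auto
  then show ?case
    using exec_Loop_Suc.prems w queue_Run_rotate[of ?k w1 "Unit r # w2"] by auto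
qed

end

lemma queue_step_inv:
  assumes "w @ concat (map snd ((u, v) # qs)) = concat (map fst ((u, v) # qs)) @
      f" "length u \<le> length w"
  obtains w' where "w = u @ w'" "(w' @ v) @ concat (map snd qs) = concat (map fst qs) @ f"
proof -
  have eq: "w @ v @ concat (map snd qs) = u @ concat (map fst qs) @ f" using assms(1) by simp
  then have "u = take (length u) w"
    using assms(2) by (metis append_eq_append_conv_if append_eq_conv_conj)
  then have w: "w = u @ drop (length u) w" by (metis append_take_drop_id)
  then have "drop (length u) w @ v @ concat (map snd qs) = concat (map fst qs) @ f"
    using eq by (metis append.assoc same_append_eq)
  then show ?thesis using that[OF w] by simp
qed

abbreviation units :: "letter list \<Rightarrow> bool" where "units w \<equiv> set w \<subseteq> range Unit"

text \<open>
  The words that can occur when a configuration is simulated.  While the head is \<open>Test\<close>, the units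
  already passed are those between \<open>Mark\<close> and the head in cyclic order, and there is no \<open>Unit r\<close>
  among them.  The two forms tell which of \<open>Mark\<close> and \<open>Test\<close> comes first in the queue.
\<close>

inductive encodes :: "letter list \<Rightarrow> instr list \<Rightarrow> store \<Rightarrow> bool" where
  encodes_Run: "represents (w1 @ w2) s \<Longrightarrow> encodes (w1 @ Run k # w2) k s"
| encodes_Mark_Test: "units (p @ x @ y) \<Longrightarrow> Unit r \<notin> set x \<Longrightarrow>
    (\<And>j. s j = count_list (p @ x @ y) (Unit j)) \<Longrightarrow>
    encodes (p @ Mark # x @ Test (Loop r b # k) # y) (Loop r b # k) s"
| encodes_Test_Mark: "units (x2 @ y @ x1) \<Longrightarrow> Unit r \<notin> set (x1 @ x2) \<Longrightarrow>
    (\<And>j. s j = count_list (x2 @ y @ x1) (Unit j)) \<Longrightarrow>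
    encodes (x2 @ Test (Loop r b # k) # y @ Mark # x1) (Loop r b # k) s"

lemma encodes_final: "encodes w k s \<Longrightarrow> w = [Run [], Mark] \<Longrightarrow> k = [] \<and> s = (\<lambda>_. 0)"
proof (induction rule: encodes.induct)
  case (encodes_Run w1 w2 s k)
  then have "w1 = []" "k = []" "w2 = [Mark]"
    by (auto simp: Cons_eq_append_conv append_eq_Cons_conv)
  moreover have "s = (\<lambda>_. 0)" using encodes_Run calculation by (auto simp: represents_def fun_eq_iff)
  ultimately show ?case by simp
qed (auto simp: Cons_eq_append_conv append_eq_Cons_conv)

text \<open>
  No rule removes more than two letters, so a rule can never match letters that it is about to
  append itself.
\<close>

lemma encodes_length: "encodes w k s \<Longrightarrow> 2 \<le> length w"
proof (induction rule: encodes.induct)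
  case (encodes_Run w1 w2 s k)
  then have "w1 @ w2 \<noteq> []" by (auto simp: represents_def)
  then show ?case by (cases w1; cases w2) auto
qed auto

text \<open>
  In each of the three forms the front letter determines the rule up to the choice of the head, and
  the resulting word encodes the same configuration or its successor.
\<close>

lemma queue_sound_step:
  assumes "encodes w k s" "(u, v) \<in> queue_rules C K" "w = u @ w'"
    and IH: "\<And>k s. encodes (w' @ v) k s \<Longrightarrow> exec k s (\<lambda>_. 0)"
  shows "exec k s (\<lambda>_. 0)"
  using assms(1)
proof cases
  case (encodes_Run w1 w2)
  show ?thesis
  proof (cases w1)
    case (Cons c w1')
    then have "c \<in> range Unit \<union> {Mark}" using encodes_Run by (auto simp: represents_def)
    moreover have eq: "c # w1' @ Run k # w2 = u @ w'" using encodes_Run Cons assms(3) by simp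
    ultimately have uv: "u = [c]" "v = [c]" using assms(2) by (auto elim!: queue_rules.cases)
    then have "w' @ v = w1' @ Run k # (w2 @ [c])" using eq by simp
    moreover have "represents (w1' @ (w2 @ [c])) s"
        using encodes_Run Cons by (auto simp: represents_def)
    ultimately show ?thesis
        using encodes.encodes_Run[of w1' "w2 @ [c]" s k] encodes_Run by (intro IH) simp
  next
    case Nil
    then have w: "Run k # w2 = u @ w'" and represents: "represents w2 s"
        using encodes_Run assms(3) by auto
    from assms(2) show ?thesis
    proof cases
      case (rule_move c k')
      then have "w' @ v = (w' @ [c]) @ Run k # []" "represents ((w' @ [c]) @ []) s"
        using w represents by (auto simp: represents_def)
      then show ?thesis using encodes.encodes_Run[of "w' @ [c]" "[]" s k] by (intro IH) simp
    next
      case (rule_Inc r k')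
      then have "w' @ v = w' @ Run k' # [Unit r]" "represents (w' @ [Unit r]) (s(r := Suc (s r)))"
        using w represents by (auto simp: represents_def)
      then have "exec k' (s(r := Suc (s r))) (\<lambda>_. 0)"
        using encodes.encodes_Run[of w' "[Unit r]" _ k'] by (intro IH) simp
      then show ?thesis using w rule_Inc by simp
    next
      case (rule_dec r b k')
      then obtain n where n: "s r = Suc n" using represents w by (auto simp: represents_def)
      have "w' @ v = w' @ Run (b @ Loop r b # k') # []" "represents (w' @ []) (s(r := n))"
        using w represents rule_dec n by (auto simp: represents_def split: if_splits)
      then have "exec (b @ Loop r b # k') (s(r := n)) (\<lambda>_. 0)"
        using encodes.encodes_Run[of w' "[]" "s(r := n)" "b @ Loop r b # k'"] by (intro IH) simp
      then show ?thesis using w rule_dec n by (auto simp: exec_Loop_Suc_iff)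
    next
      case (rule_test r b k')
      then have "w2 = Mark # w'" "k = Loop r b # k'" using w by auto
      then have "encodes (w' @ Mark # [] @ Test (Loop r b # k') # []) k s"
        using represents \<open>w2 = Mark # w'\<close>
        by (simp only: \<open>k = _\<close>, intro encodes.encodes_Mark_Test)
            (auto simp: represents_def count_list_0_iff)
      then show ?thesis using rule_test by (intro IH) simp
    qed (use w in auto)
  qed
next
  case (encodes_Mark_Test p x y r b k')
  show ?thesis
  proof (cases p)
    case Nil
    then have "u = [Mark]" "v = [Mark]" "w' = x @ Test k # y"
      using assms(2,3) encodes_Mark_Test by (auto elim!: queue_rules.cases)
    moreover have "encodes (x @ Test k # y @ Mark # []) k s"
      using encodes_Mark_Test Nil unfolding encodes_Mark_Test(2)
      by (intro encodes_Test_Mark) (auto simp: ac_simps)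
    ultimately show ?thesis by (intro IH) simp
  next
    case (Cons c p')
    then have "c \<in> range Unit" using encodes_Mark_Test by auto
    then have "u = [c]" "v = [c]" "w' = p' @ Mark # x @ Test k # y"
      using assms(2,3) encodes_Mark_Test Cons by (auto elim!: queue_rules.cases)
    moreover have "encodes (p' @ Mark # x @ Test k # (y @ [c])) k s"
      using encodes_Mark_Test Cons unfolding encodes_Mark_Test(2)
      by (intro encodes.encodes_Mark_Test) (auto simp: ac_simps)
    ultimately show ?thesis by (intro IH) simp
  qed
next
  case (encodes_Test_Mark x2 y x1 r b k')
  show ?thesis
  proof (cases x2)
    case (Cons c x2')
    then have "c \<in> range Unit" using encodes_Test_Mark by auto
    then have "u = [c]" "v = [c]" "w' = x2' @ Test k # y @ Mark # x1"
      using assms(2,3) encodes_Test_Mark Cons by (auto elim!: queue_rules.cases)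
    moreover have "encodes (x2' @ Test k # y @ Mark # (x1 @ [c])) k s"
      using encodes_Test_Mark Cons unfolding encodes_Test_Mark(2)
      by (intro encodes.encodes_Test_Mark) (auto simp: ac_simps)
    ultimately show ?thesis by (intro IH) simp
  next
    case Nil
    then have w: "Test (Loop r b # k') # y @ Mark # x1 = u @ w'"
        using encodes_Test_Mark assms(3) by simp
    from assms(2) show ?thesis
    proof cases
      case (rule_skip r' b' k'' j)
      then obtain y' where "y = Unit j # y'" "w' = y' @ Mark # x1" using w by (cases y) auto
      moreover have "encodes (y' @ Mark # (x1 @ [Unit j]) @
          Test (Loop r b # k') # []) (Loop r b # k') s"
        using encodes_Test_Mark Nil rule_skip w calculation
        by (intro encodes.encodes_Mark_Test) (auto simp: ac_simps)
      ultimately show ?thesis using rule_skip w encodes_Test_Mark(2) by (intro IH) simp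
    next
      case (rule_exit r' b' k'')
      then have y: "y = []" "w' = x1" "k'' = k'"
        using w encodes_Test_Mark by (cases y; auto)+
      moreover have "Mark \<notin> set x1" using encodes_Test_Mark by auto
      ultimately have "represents (x1 @ [Mark]) s"
        using encodes_Test_Mark Nil by (auto simp: represents_def count_list_0_iff)
      then have "exec k' s (\<lambda>_. 0)"
        using y rule_exit encodes.encodes_Run[of x1 "[Mark]" s k'] by (intro IH) simp
      moreover have "s r = 0" using encodes_Test_Mark(5)[of r] encodes_Test_Mark y Nil
        by (simp add: count_list_0_iff)
      ultimately show ?thesis using encodes_Test_Mark(2) by simp
    qed (use w in auto)
  qed
qed

lemma queue_sound:
  assumes "queue_solvable (queue_rules C K) w [Run [], Mark]" "encodes w k s"
  shows "exec k s (\<lambda>_. 0)"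
proof -
  have "set qs \<subseteq> queue_rules C K \<Longrightarrow> w @ concat (map snd qs) = concat (map fst qs) @ [Run [], Mark] \<Longrightarrow>
      encodes w k s \<Longrightarrow> exec k s (\<lambda>_. 0)" for qs w k s
  proof (induction qs arbitrary: w k s)
    case Nil
    then show ?case using encodes_final by fastforce
  next
    case (Cons q qs)
    obtain u v where q: "q = (u, v)" by force
    have uv: "(u, v) \<in> queue_rules C K" using Cons.prems q by auto
    then have "length u \<le> 2" by (auto elim: queue_rules.cases)
    then have "length u \<le> length w" using encodes_length[OF Cons.prems(3)] by simp
    then obtain w' where "w = u @ w'" "(w' @ v) @ concat (map snd qs) = concat (map fst qs) @
        [Run [], Mark]"
      using queue_step_inv[of w u v qs] Cons.prems q by auto
    then show ?case
      using Cons.IH[of "w' @ v"] Cons.prems(1) by (intro queue_sound_step[OF Cons.prems(3) uv]) auto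
  qed
  with assms show ?thesis unfolding queue_solvable_def by blast
qed

text \<open>
  The remaining programs that can arise from \<open>p\<close> followed by \<open>k\<close>.  There are finitely many, although
  \<open>exec\<close> unfolds loops: a loop body is always followed by the same rest.
\<close>

fun continuations :: "instr list \<Rightarrow> instr list \<Rightarrow> instr list set" where
  "continuations [] k = {k}"
| "continuations (Inc r # p) k = insert (Inc r # p @ k) (continuations p k)"
| "continuations (Loop r b # p) k =
     insert (Loop r b # p @ k) (continuations p k \<union> continuations b (Loop r b # p @ k))"

lemma finite_continuations: "finite (continuations p k)"
  by (induction p k rule: continuations.induct) auto

lemma continuations_self: "p @ k \<in> continuations p k"
  by (cases "(p, k)" rule: continuations.cases) auto

fun successors :: "instr list \<Rightarrow> instr list set" where
  "successors [] = {}"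
| "successors (Inc r # k) = {k}"
| "successors (Loop r b # k) = {k, b @ Loop r b # k}"

lemma continuations_closed:
  "c \<in> continuations p k \<Longrightarrow> c \<noteq> k \<Longrightarrow> successors c \<subseteq> continuations p k"
proof (induction p k rule: continuations.induct)
  case (2 r p k)
  then show ?case using continuations_self[of p k] by auto
next
  case (3 r b p k)
  let ?k = "Loop r b # p @ k"
  show ?case
  proof (cases "c = ?k")
    case True
    then show ?thesis
      using continuations_self[of p k] continuations_self[of b ?k] by simp
  next
    case False
    then have "c \<in> continuations p k \<or> c \<in> continuations b ?k" using "3.prems"(1) by simp
    then have "successors c \<subseteq> continuations p k \<or> successors c \<subseteq> continuations b ?k"
      using "3.IH" "3.prems"(2) False by blast
    then show ?thesis unfolding continuations.simps by blast
  qed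
qed simp

lemma program_as_queue:
  obtains R where "finite R" "\<And>u v. (u, v) \<in> R \<Longrightarrow> u \<noteq> [] \<and> v \<noteq> []"
    "\<And>x. queue_solvable R ([Run p, Mark] @ replicate x (Unit 0)) [Run [], Mark] \<longleftrightarrow>
      exec p ((\<lambda>_. 0)(0 := x)) (\<lambda>_. 0)"
proof
  define K where "K = continuations p []"
  define C where "C = insert 0 {r. \<exists>k. Inc r # k \<in> K}"
  have K: "k \<in> K \<and> r \<in> C" if "Inc r # k \<in> K" for r k
  proof -
    have "k \<in> K" using continuations_closed[of "Inc r # k" p "[]"] that unfolding K_def by simp
    moreover have "r \<in> C" using that unfolding C_def by blast
    ultimately show ?thesis ..
  qed
  have K': "k \<in> K \<and> b @ Loop r b # k \<in> K" if "Loop r b # k \<in> K" for r b k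
    using continuations_closed[of "Loop r b # k" p "[]"] that unfolding K_def by simp
  have "{r. \<exists>k. Inc r # k \<in> K} \<subseteq> (\<lambda>k. case k of Inc r # _ \<Rightarrow> r) ` K"
    by (force simp: image_iff)
  moreover have "finite K" unfolding K_def by (rule finite_continuations)
  ultimately have "finite C" unfolding C_def by (meson finite_imageI finite_insert finite_subset)
  then show "finite (queue_rules C K)" using \<open>finite K\<close> by (rule finite_queue_rules)
  show "u \<noteq> [] \<and> v \<noteq> []" if "(u, v) \<in> queue_rules C K" for u v using queue_rules_nonempty[OF that] .
  fix x
  \<comment> \<open>The start configuration has \<open>x\<close> in register \<open>0\<close> and all other registers empty.\<close>
  let ?w = "Mark # replicate x (Unit 0)" and ?s = "(\<lambda>_. 0)(0 := x) :: store"
  have "count_list (replicate x (Unit 0)) c = (if c = Unit 0 then x else 0)" for c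
    by (induction x) auto
  then have represents: "represents ?w ?s" by (auto simp: represents_def)
  have pK: "p \<in> K" using continuations_self[of p "[]"] unfolding K_def by simp
  have C: "set ?w \<subseteq> plain C" by (auto simp: C_def)
  have "queue_solvable (queue_rules C K) (Run p # ?w) [Run [], Mark]" if "exec p ?s (\<lambda>_. 0)"
    using queue_complete[OF K K' that refl pK C represents] .
  moreover have "encodes ([] @ Run p # ?w) p ?s" using represents by (intro encodes_Run) simp
  then have "exec p ?s (\<lambda>_. 0)" if "queue_solvable (queue_rules C K) (Run p # ?w) [Run [], Mark]"
    using queue_sound[OF that] by simp
  ultimately show "queue_solvable (queue_rules C K) ([Run p, Mark] @
      replicate x (Unit 0)) [Run [], Mark] \<longleftrightarrow>
      exec p ?s (\<lambda>_. 0)"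
    by auto
qed

section \<open>Undecidability of Post's problem for some number of pairs\<close>

text \<open>
  Post's problem over an arbitrary type of letters; only the set of pairs matters.
\<close>

definition matchable :: "('a list \<times> 'a list) set \<Rightarrow> bool" where
  "matchable S \<longleftrightarrow> (\<exists>qs. qs \<noteq> [] \<and> set qs \<subseteq> S \<and> concat (map fst qs) = concat (map snd qs))"

lemma pcp_solvable_iff_matchable: "pcp_solvable ps \<longleftrightarrow> matchable (set ps)"
proof
  assume "pcp_solvable ps"
  then obtain "is" where "is \<noteq> []" "set is \<subseteq> {..<length ps}"
      "concat (map (\<lambda>i. fst (ps ! i)) is) = concat (map (\<lambda>i. snd (ps ! i)) is)"
    unfolding pcp_solvable_def by blast
  then show "matchable (set ps)"
    unfolding matchable_def
    by (intro exI[of _ "map ((!) ps) is"]) (auto simp: comp_def)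
next
  assume "matchable (set ps)"
  then obtain qs where qs: "qs \<noteq> []" "set qs \<subseteq> set ps" "concat (map fst qs) = concat (map snd qs)"
    unfolding matchable_def by blast
  have "\<exists>is. set is \<subseteq> {..<length ps} \<and> map ((!) ps) is = qs"
    using qs(2)
  proof (induction qs)
    case (Cons q qs)
    then obtain "is" i where "set is \<subseteq> {..<length ps}" "map ((!) ps) is = qs" "i < length ps" "ps !
        i = q"
      by (auto simp: in_set_conv_nth)
    then show ?case by (intro exI[of _ "i # is"]) auto
  qed simp
  then obtain "is" where "set is \<subseteq> {..<length ps}" "qs = map ((!) ps) is" by blast
  with qs show "pcp_solvable ps"
    unfolding pcp_solvable_def by (intro exI[of _ "is"]) (auto simp: comp_def)
qed

lemma matchable_map:
  assumes "inj e"
  shows "matchable (map_prod (map e) (map e) ` S) \<longleftrightarrow> matchable S"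
proof -
  have image: "concat (map fst (map (map_prod (map e) (map e)) qs)) = map e (concat (map fst qs))"
    "concat (map snd (map (map_prod (map e) (map e)) qs)) = map e (concat (map snd qs))" for qs
    by (induction qs) auto
  have "matchable (map_prod (map e) (map e) ` S) \<longleftrightarrow>
      (\<exists>qs. qs \<noteq> [] \<and> set qs \<subseteq> S \<and> map e (concat (map fst qs)) = map e (concat (map snd qs)))"
    (is "_ \<longleftrightarrow> ?R")
  proof
    assume "matchable (map_prod (map e) (map e) ` S)"
    then obtain qs' where qs': "qs' \<noteq> []" "qs' \<in> lists (map_prod (map e) (map e) ` S)"
        "concat (map fst qs') = concat (map snd qs')"
      unfolding matchable_def by blast
    then obtain qs where "qs \<in> lists S" "qs' = map (map_prod (map e) (map e)) qs"
      unfolding lists_image by blast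
    with qs' image[of qs] show ?R by (intro exI[of _ qs]) auto
  next
    assume ?R
    then obtain qs where "qs \<noteq> []" "set qs \<subseteq> S"
        "map e (concat (map fst qs)) = map e (concat (map snd qs))"
      by blast
    then show "matchable (map_prod (map e) (map e) ` S)"
      unfolding matchable_def using image[of qs]
      by (intro exI[of _ "map (map_prod (map e) (map e)) qs"]) auto
  qed
  then show ?thesis unfolding matchable_def using assms by (simp add: inj_map_eq_map)
qed

text \<open>
  Post's problem prescribes no ends.  They are enforced by writing the upper words with a separator
  before and the lower words with a separator after each letter: only a pair that
  supplies the missing separator can come first, and only one that supplies \<open>End\<close> can close.
\<close>

datatype 'a sep = Begin | Sep | End | Letter 'a

definition sep_before :: "'a list \<Rightarrow> 'a sep list" where
  "sep_before w = concat (map (\<lambda>a. [Sep, Letter a]) w)"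

definition sep_after :: "'a list \<Rightarrow> 'a sep list" where
  "sep_after w = concat (map (\<lambda>a. [Letter a, Sep]) w)"

lemma sep_simps [simp]:
  "sep_before [] = []" "sep_before (a # w) = Sep # Letter a # sep_before w"
  "sep_before (v @ w) = sep_before v @ sep_before w"
  "sep_after [] = []" "sep_after (a # w) = Letter a # Sep # sep_after w"
  "sep_after (v @ w) = sep_after v @ sep_after w"
  by (simp_all add: sep_before_def sep_after_def)

lemma Sep_sep_after: "Sep # sep_after w = sep_before w @ [Sep]"
  by (induction w) auto

lemma sep_before_inject: "sep_before v = sep_before w \<longleftrightarrow> v = w"
proof (induction v arbitrary: w)
  case Nil
  then show ?case by (cases w) auto
next
  case (Cons a v)
  then show ?case by (cases w) auto
qed

lemma set_sep_before: "set (sep_before w) \<subseteq> insert Sep (range Letter)"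
  by (induction w) auto

lemma even_length_sep_before: "even (length (sep_before w))"
  by (induction w) auto

lemma sep_before_neq: "sep_before v \<noteq> sep_before w @ [Sep]"
proof
  assume "sep_before v = sep_before w @ [Sep]"
  then have "length (sep_before v) = Suc (length (sep_before w))" by simp
  moreover have "even (length (sep_before v))" "even (length (sep_before w))"
    by (rule even_length_sep_before)+
  ultimately show False by simp
qed

lemma append_Cons_first_eq:
  "x \<notin> set xs \<Longrightarrow> x \<notin> set xs' \<Longrightarrow> xs @ x # ys = xs' @ x # ys' \<Longrightarrow> xs = xs'"
proof (induction xs arbitrary: xs')
  case Nil
  then show ?case by (cases xs') auto
next
  case (Cons a xs)
  then show ?case by (cases xs') auto
qed

definition pcp_of_queue :: "('a list \<times> 'a list) set \<Rightarrow> 'a list \<Rightarrow> 'a list \<Rightarrow> ('a sep list \<times> 'a sep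
    list) set" where
  "pcp_of_queue R w f = insert ([Begin], Begin # Sep # sep_after w)
     (insert (sep_before f @ [Sep, End], [End]) ((\<lambda>(u, v). (sep_before u, sep_after v)) ` R))"

lemma concat_sep:
  "concat (map fst (map (\<lambda>(u, v). (sep_before u, sep_after v)) qs)) = sep_before (concat (map fst
      qs))"
  "concat (map snd (map (\<lambda>(u, v). (sep_before u, sep_after v)) qs)) = sep_after (concat (map snd qs))"
  by (induction qs) auto

text \<open>
  In a solution the starting pair comes first.  The ordinary pairs after it can be followed neither
  by the end of the solution nor by another starting pair, since the upper word of ordinary pairs
  has even length and the lower word, with the separator of the starting pair, has odd length.
  What is left is the closing pair, and cutting there gives the equation of the queue.
\<close>

lemma matchable_pcp_of_queue:
  assumes R: "\<And>u v. (u, v) \<in> R \<Longrightarrow> u \<noteq> [] \<and> v \<noteq> []"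
  shows "matchable (pcp_of_queue R w f) \<longleftrightarrow> queue_solvable R w f"
proof
  let ?g = "\<lambda>(u, v). (sep_before u, sep_after v)"
  let ?start = "([Begin], Begin # Sep # sep_after w)" and ?end = "(sep_before f @ [Sep, End], [End])"
  assume "queue_solvable R w f"
  then obtain qs where qs: "set qs \<subseteq> R" "w @ concat (map snd qs) = concat (map fst qs) @ f"
    unfolding queue_solvable_def by blast
  let ?qs = "?start # map ?g qs @ [?end]"
  have "concat (map snd ?qs) = Begin # (Sep # sep_after (w @ concat (map snd qs))) @ [End]"
    using concat_sep(2)[of qs] by simp
  also have "\<dots> = concat (map fst ?qs)"
    unfolding Sep_sep_after qs(2) using concat_sep(1)[of qs] by simp
  finally show "matchable (pcp_of_queue R w f)"
    unfolding matchable_def using qs(1)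
    by (intro exI[of _ ?qs]) (auto simp: pcp_of_queue_def)
next
  let ?g = "\<lambda>(u, v). (sep_before u, sep_after v)"
  let ?start = "([Begin], Begin # Sep # sep_after w)" and ?end = "(sep_before f @ [Sep, End], [End])"
  assume "matchable (pcp_of_queue R w f)"
  then obtain q qs where qs: "set (q # qs) \<subseteq> pcp_of_queue R w f"
      "concat (map fst (q # qs)) = concat (map snd (q # qs))"
    unfolding matchable_def by (metis neq_Nil_conv)
  have "q = ?start"
  proof -
    have "q \<noteq> ?g (u, v)" if "(u, v) \<in> R" for u v
      using qs(2) R[OF that] by (cases u; cases v) auto
    moreover have "q \<noteq> ?end" using qs(2) by (cases f) auto
    ultimately show ?thesis using qs(1) by (auto simp: pcp_of_queue_def)
  qed
  define mid where "mid = takeWhile (\<lambda>q. q \<in> ?g ` R) qs"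
  define rest where "rest = dropWhile (\<lambda>q. q \<in> ?g ` R) qs"
  have qs_split: "qs = mid @ rest" by (simp add: mid_def rest_def)
  have "mid \<in> lists (?g ` R)" unfolding mid_def by (auto dest: set_takeWhileD)
  then obtain ms where ms: "set ms \<subseteq> R" "mid = map ?g ms" unfolding lists_image by auto
  let ?U = "concat (map fst ms)" and ?V = "concat (map snd ms)"
  have eq: "sep_before ?U @ concat (map fst rest) =
      (sep_before (w @ ?V) @ [Sep]) @ concat (map snd rest)"
    using qs(2) concat_sep[of ms]
        unfolding Sep_sep_after[symmetric] qs_split ms(2) \<open>q = ?start\<close> by simp
  show "queue_solvable R w f"
  proof (cases rest)
    case Nil
    then have False using eq sep_before_neq[of ?U "w @ ?V"] by simp
    then show ?thesis ..
  next
    case (Cons r rs)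
    then have "r \<notin> ?g ` R" unfolding rest_def using hd_dropWhile[of "\<lambda>q. q \<in> ?g ` R" qs] by auto
    moreover have "r \<in> pcp_of_queue R w f" using qs(1) qs_split Cons by auto
    ultimately consider "r = ?start" | "r = ?end" unfolding pcp_of_queue_def by blast
    then show ?thesis
    proof cases
      case 1
      have *: "Begin \<notin> set (sep_before x)" for x :: "'a list" using set_sep_before[of x] by auto
      have "sep_before ?U @ Begin # concat (map fst rs) =
          (sep_before (w @ ?V) @ [Sep]) @ Begin # (Sep # sep_after w @ concat (map snd rs))"
        using eq unfolding Cons 1 by simp
      then have "sep_before ?U = sep_before (w @ ?V) @ [Sep]"
        by (rule append_Cons_first_eq[rotated 2]) (simp_all add: *)
      then show ?thesis using sep_before_neq by blast
    next
      case 2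
      have *: "End \<notin> set (sep_before x)" for x :: "'a list" using set_sep_before[of x] by auto
      have "(sep_before (?U @ f) @ [Sep]) @ End # concat (map fst rs) =
          (sep_before (w @ ?V) @ [Sep]) @ End # concat (map snd rs)"
        using eq unfolding Cons 2 by simp
      then have "sep_before (?U @ f) @ [Sep] = sep_before (w @ ?V) @ [Sep]"
        by (rule append_Cons_first_eq[rotated 2]) (simp_all add: *)
      then have "w @ ?V = ?U @ f" using sep_before_inject by (metis butlast_snoc)
      then show ?thesis unfolding queue_solvable_def using ms(1) by blast
    qed
  qed
qed

instance instr :: countable by countable_datatype
instance letter :: countable by countable_datatype
instance sep :: (countable) countable by countable_datatype

text \<open>
  The initial head of the program is coded by \<open>0\<close> whatever the program is.  The starting pair then
  depends on the input only, which the diagonal argument exploits.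
\<close>

definition letter_code :: "instr list \<Rightarrow> letter sep \<Rightarrow> nat" where
  "letter_code p a = (if a = Letter (Run p) then 0 else Suc (to_nat a))"

lemma inj_letter_code: "inj (letter_code p)"
  by (auto simp: inj_def letter_code_def)

definition start_pair :: "nat \<Rightarrow> word \<times> word" where
  "start_pair x = (let c = \<lambda>a :: letter sep. Suc (to_nat a) in
     ([c Begin], [c Begin, c Sep, 0, c Sep, c (Letter Mark), c Sep] @
        concat (replicate x [c (Letter (Unit 0)), c Sep])))"

lemma halting_as_pcp:
  obtains ps where "\<And>x. (\<exists>y. rec_eval f [x] y) \<longleftrightarrow> pcp_solvable (start_pair x # ps)"
proof -
  let ?p = "halting_program f"
  obtain R where R: "finite R" "\<And>u v. (u, v) \<in> R \<Longrightarrow> u \<noteq> [] \<and> v \<noteq> []"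
    and solvable: "\<And>x. queue_solvable R ([Run ?p, Mark] @ replicate x (Unit 0)) [Run [], Mark] \<longleftrightarrow>
      exec ?p ((\<lambda>_. 0)(0 := x)) (\<lambda>_. 0)"
    using program_as_queue[of ?p] by blast
  let ?e = "map_prod (map (letter_code ?p)) (map (letter_code ?p))"
  let ?S = "insert (sep_before [Run [], Mark] @
      [Sep, End], [End]) ((\<lambda>(u, v). (sep_before u, sep_after v)) ` R)"
  have "finite (?e ` ?S)" using R(1) by blast
  then obtain ps where ps: "set ps = ?e ` ?S" using finite_list by blast
  have "(\<exists>y. rec_eval f [x] y) \<longleftrightarrow> pcp_solvable (start_pair x # ps)" for x
  proof -
    let ?w = "[Run ?p, Mark] @ replicate x (Unit 0)"
    have "map (letter_code ?p) (sep_after (replicate n (Unit 0))) =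
        concat (replicate n [Suc (to_nat (Letter (Unit 0))), Suc (to_nat (Sep :: letter sep))])" for n
      by (induction n) (auto simp: letter_code_def)
    then have "?e ([Begin], Begin # Sep # sep_after ?w) = start_pair x"
      by (simp add: start_pair_def Let_def letter_code_def)
    then have "set (start_pair x # ps) = ?e ` pcp_of_queue R ?w [Run [], Mark]"
      unfolding pcp_of_queue_def image_insert[of ?e "([Begin], Begin # Sep # sep_after ?w)"]
      by (simp only: ps list.set)
    then have "pcp_solvable (start_pair x # ps) \<longleftrightarrow> queue_solvable R ?w [Run [], Mark]"
      unfolding pcp_solvable_iff_matchable
      by (simp only: matchable_map[OF inj_letter_code] matchable_pcp_of_queue[OF R(2)])
    then show ?thesis unfolding solvable exec_halting_program by simp
  qed
  then show ?thesis using that by blast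
qed

abbreviation pair_code :: "word \<times> word \<Rightarrow> nat" where
  "pair_code q \<equiv> pair (list_encode (fst q)) (list_encode (snd q))"

lemma pcp_code_Cons: "pcp_code (q # ps) = Suc (pair (pair_code q) (pcp_code ps))"
  by (simp add: pcp_code_def case_prod_unfold)

lemma computable_list_encode_Cons:
  "computable (\<lambda>x. list_encode (w x)) \<Longrightarrow> computable (\<lambda>x. list_encode (a # w x))"
  unfolding list_encode.simps by (intro computable_Suc computable_pair computable_const)

lemma computable_start_pair: "computable (\<lambda>x. pair_code (start_pair x))"
proof -
  have "computable (\<lambda>x. list_encode (concat (replicate x [a, b])))" for a b
  proof -
    have "list_encode (concat (replicate n [a, b])) =
        ((\<lambda>c. Suc (pair a (Suc (pair b c)))) ^^ n) 0" for n
      by (induction n) auto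
    moreover have "computable (\<lambda>n. ((\<lambda>c. Suc (pair a (Suc (pair b c)))) ^^ n) 0)"
      by (rule computable_funpow) (intro computable_intros)+
    ultimately show ?thesis by presburger
  qed
  then show ?thesis
    unfolding start_pair_def Let_def fst_conv snd_conv append_Cons append_Nil
    by (intro computable_pair computable_const computable_list_encode_Cons)
qed

lemma foldl_push: "foldl (\<lambda>c a. Suc (pair a c)) (list_encode v) w = list_encode (rev w @ v)"
proof (induction w arbitrary: v)
  case (Cons a w)
  then show ?case using Cons[of "a # v"] by simp
qed simp

text \<open>
  Replacing indices out of range by \<open>0\<close> makes every nonempty list of indices a candidate, which
  spares the search a validity check.
\<close>

lemma pcp_solvable_clamp:
  assumes "ps \<noteq> []"
  defines "q \<equiv> \<lambda>i. ps ! (if i < length ps then i else 0)"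
  shows "pcp_solvable ps \<longleftrightarrow>
    (\<exists>is. is \<noteq> [] \<and> concat (map (\<lambda>i. fst (q i)) is) = concat (map (\<lambda>i. snd (q i)) is))"
proof
  assume "pcp_solvable ps"
  then obtain "is" where "is": "is \<noteq> []" "set is \<subseteq> {..<length ps}"
      "concat (map (\<lambda>i. fst (ps ! i)) is) = concat (map (\<lambda>i. snd (ps ! i)) is)"
    unfolding pcp_solvable_def by blast
  then have "q i = ps ! i" if "i \<in> set is" for i using that by (auto simp: q_def)
  with "is" show "\<exists>is. is \<noteq> [] \<and> concat (map (\<lambda>i. fst (q i)) is) = concat (map (\<lambda>i. snd (q i)) is)"
    by (intro exI[of _ "is"]) (simp cong: map_cong)
next
  assume "\<exists>is. is \<noteq> [] \<and> concat (map (\<lambda>i. fst (q i)) is) = concat (map (\<lambda>i. snd (q i)) is)"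
  then obtain "is" where "is \<noteq> []" "concat (map (\<lambda>i. fst (q i)) is) = concat (map (\<lambda>i. snd (q i)) is)"
    by blast
  with assms(1) show "pcp_solvable ps"
    unfolding pcp_solvable_def
    by (intro exI[of _ "map (\<lambda>i. if i < length ps then i else 0) is"]) (auto simp: comp_def q_def)
qed

text \<open>
  Searching for a solution is a recursive function.  The words of a candidate are compared in
  reverse, because pushing letters one by one reverses them.
\<close>

lemma pcp_semidecidable:
  obtains f where "\<And>ps. (\<exists>y. rec_eval f [pcp_code ps] y) \<longleftrightarrow>
    pcp_solvable (start_pair (pcp_code ps) # ps)"
proof -
  define start where "start c = pair_code (start_pair c)" for c
  define q where "q c i = code_nth (Suc (pair (start c) c))
    (if i < Suc (foldl (\<lambda>n a. Suc n) 0 (list_decode c)) then i else 0)" for c i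
  define top where "top n c = foldl (\<lambda>t i. foldl (\<lambda>t a. Suc (pair a t)) t (list_decode (proj1 (q c
      i)))) 0 (list_decode n)" for n c
  define bot where "bot n c = foldl (\<lambda>t i. foldl (\<lambda>t a. Suc (pair a t)) t (list_decode (proj2 (q c
      i)))) 0 (list_decode n)" for n c
  define check where "check n c = (if n = 0 then 1 else
      if top n c = bot n c then 0 else 1 :: nat)" for n c
  have start: "computable (\<lambda>x. start (g x))" if "computable g" for g
    unfolding start_def using computable_comp[OF computable_start_pair that] .
  have "computable (\<lambda>z. check (proj1 z) (proj2 z))"
    unfolding check_def top_def bot_def q_def
    by (intro computable_intros computable_foldl computable_code_nth start)
  then obtain f where f: "\<And>n c. rec_eval f [n, c] (check n c)"
    using computable2I unfolding computable2_def by blast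
  have check_iff: "(\<exists>n. check n (pcp_code ps) = 0) \<longleftrightarrow>
      pcp_solvable (start_pair (pcp_code ps) # ps)" for ps
  proof -
    let ?c = "pcp_code ps"
    define qs where "qs = start_pair ?c # ps"
    define sel where "sel i = qs ! (if i < length qs then i else 0)" for i
    have len: "foldl (\<lambda>n a. Suc n) k xs = k + length xs" for k and xs :: "nat list"
      by (induction xs arbitrary: k) auto
    have code: "Suc (pair (start ?c) ?c) = list_encode (map pair_code qs)"
      by (simp add: start_def qs_def pcp_code_def case_prod_unfold)
    have length: "Suc (foldl (\<lambda>n a. Suc n) 0 (list_decode ?c)) = length qs"
      by (simp add: len qs_def pcp_code_def)
    have "(if i < length qs then i else 0) < length qs" for i by (simp add: qs_def)
    then have q: "q ?c i = pair_code (sel i)" for i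
      unfolding q_def code length sel_def by (simp add: code_nth_list_encode del: if_split)
    have "foldl (\<lambda>t i. foldl (\<lambda>t a. Suc (pair a t)) t (list_decode (proj1 (q ?c i)))) (list_encode
        v) is =
        list_encode (rev (concat (map (\<lambda>i. fst (sel i)) is)) @ v)" for v "is"
      by (induction "is" arbitrary: v) (auto simp: q foldl_push)
    from this[of "[]"] have top: "top (list_encode is) ?c = list_encode (rev (concat (map (\<lambda>i. fst
        (sel i)) is)))" for "is"
      by (simp add: top_def)
    have "foldl (\<lambda>t i. foldl (\<lambda>t a. Suc (pair a t)) t (list_decode (proj2 (q ?c i)))) (list_encode
        v) is =
        list_encode (rev (concat (map (\<lambda>i. snd (sel i)) is)) @ v)" for v "is"
      by (induction "is" arbitrary: v) (auto simp: q foldl_push)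
    from this[of "[]"] have bot: "bot (list_encode is) ?c = list_encode (rev (concat (map (\<lambda>i. snd
        (sel i)) is)))" for "is"
      by (simp add: bot_def)
    have "check (list_encode is) ?c = 0 \<longleftrightarrow>
        is \<noteq> [] \<and> concat (map (\<lambda>i. fst (sel i)) is) = concat (map (\<lambda>i. snd (sel i)) is)" for "is"
      unfolding check_def top bot list_encode_eq rev_is_rev_conv by (cases "is") auto
    moreover have "(\<exists>n. check n ?c = 0) \<longleftrightarrow> (\<exists>is. check (list_encode is) ?c = 0)"
      by (metis list_decode_inverse)
    ultimately show ?thesis
      using pcp_solvable_clamp[of qs] unfolding sel_def by (simp add: qs_def)
  qed
  have "(\<exists>y. rec_eval (Mu f) [c] y) \<longleftrightarrow> (\<exists>n. check n c = 0)" for c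
  proof
    assume "\<exists>y. rec_eval (Mu f) [c] y"
    then show "\<exists>n. check n c = 0"
      unfolding rec_eval_Mu_iff using f rec_eval_deterministic by metis
  next
    assume ex: "\<exists>n. check n c = 0"
    define n where "n = (LEAST n. check n c = 0)"
    have "check n c = 0" unfolding n_def by (rule LeastI_ex[OF ex])
    moreover have "check m c \<noteq> 0" if "m < n" for m using that not_less_Least unfolding n_def by blast
    ultimately have "rec_eval (Mu f) [c] n"
      unfolding rec_eval_Mu_iff using f by (metis not0_implies_Suc)
    then show "\<exists>y. rec_eval (Mu f) [c] y" ..
  qed
  then show ?thesis using that check_iff by blast
qed

text \<open>
  Post's problem is its own universal machine.  Let \<open>W\<close> halt on the code of \<open>ps\<close> iff \<open>ps\<close> extended by
  the starting pair for this code is solvable.  Halting of \<open>W\<close> is itself Post's problem for a fixed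
  number of pairs.  If that was decidable, some \<open>h\<close> would halt exactly where \<open>W\<close> does not; the pairs
  that describe halting of \<open>h\<close> yield a contradiction at their own code.
\<close>

theorem pcp_undecidable: "\<exists>r. \<not> pcp_decidable r"
proof -
  obtain W where W: "\<And>ps. (\<exists>y. rec_eval W [pcp_code ps] y) \<longleftrightarrow>
      pcp_solvable (start_pair (pcp_code ps) # ps)"
    using pcp_semidecidable by blast
  obtain psW where psW: "\<And>x. (\<exists>y. rec_eval W [x] y) \<longleftrightarrow> pcp_solvable (start_pair x # psW)"
    using halting_as_pcp by blast
  have "\<not> pcp_decidable (Suc (length psW))"
  proof
    assume "pcp_decidable (Suc (length psW))"
    then obtain d where d': "\<And>ps. length ps = Suc (length psW) \<Longrightarrow>
        rec_eval d [pcp_code ps] (if pcp_solvable ps then 1 else 0)"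
      unfolding pcp_decidable_def decidable_def pcp_instances_def by blast
    have d: "rec_eval d [pcp_code (start_pair x # psW)] (if \<exists>y. rec_eval W [x] y then 1 else 0)" for x
      unfolding psW by (rule d') simp
    have "computable (\<lambda>x. pcp_code (start_pair x # psW))"
      unfolding pcp_code_Cons
          by (intro computable_Suc computable_pair[OF computable_start_pair] computable_const)
    then obtain g where g: "\<And>x. rec_eval g [x] (pcp_code (start_pair x # psW))"
      unfolding computable_def by blast
    \<comment> \<open>\<open>Mu (Proj 1)\<close> applied to \<open>v\<close> looks for an \<open>n\<close> with \<open>v = 0\<close>, so it halts iff \<open>v = 0\<close>.\<close>
    let ?h = "Comp (Mu (Proj 1)) [Comp d [g]]"
    have h: "(\<exists>y. rec_eval ?h [x] y) \<longleftrightarrow> \<not> (\<exists>y. rec_eval W [x] y)" for x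
    proof -
      let ?v = "if \<exists>y. rec_eval W [x] y then 1 else 0 :: nat"
      have "rec_eval (Comp d [g]) [x] ?v" by (rule rec_eval_Comp1[OF g d])
      then have "rec_eval (Comp d [g]) [x] v \<longleftrightarrow> v = ?v" for v
        using rec_eval_deterministic by blast
      then have "rec_eval ?h [x] y \<longleftrightarrow> rec_eval (Mu (Proj 1)) [?v] y" for y
        by (subst rec_eval_Comp_iff) (simp add: list_all2_Cons1)
      moreover have "rec_eval (Mu (Proj 1)) [?v] y \<longleftrightarrow> ?v = 0 \<and> y = 0" for y
        by (auto simp: rec_eval_Mu_iff rec_eval_Proj_iff)
      ultimately show ?thesis by auto
    qed
    obtain psh where psh: "\<And>x. (\<exists>y. rec_eval ?h [x] y) \<longleftrightarrow> pcp_solvable (start_pair x # psh)"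
      using halting_as_pcp by blast
    show False using h[of "pcp_code psh"] psh[of "pcp_code psh"] W[of psh] by blast
  qed
  then show ?thesis ..
qed

section \<open>Reduction to the zero corner problem for two matrices\<close>

text \<open>
  Words as numerals in base \<open>b\<close>.  Letters are shifted by one: without a digit \<open>0\<close> there are no leading
  zeros, and the numeral determines the word.
\<close>

definition numeral_value :: "nat \<Rightarrow> word \<Rightarrow> nat" where
  "numeral_value b u = foldl (\<lambda>s a. b * s + Suc a) 0 u"

lemma numeral_value_Nil: "numeral_value b [] = 0"
  and numeral_value_snoc: "numeral_value b (u @ [a]) = b * numeral_value b u + Suc a"
  by (simp_all add: numeral_value_def)

lemma numeral_value_append:
  "numeral_value b (u @ v) = numeral_value b u * b ^ length v + numeral_value b v"
proof (induction v rule: rev_induct)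
  case (snoc a v)
  then show ?case
    unfolding append_assoc[symmetric] numeral_value_snoc by (simp add: algebra_simps)
qed (simp add: numeral_value_Nil)

lemma numeral_value_inject:
  assumes "\<And>a. a \<in> set u \<union> set v \<Longrightarrow> Suc a < b"
  shows "numeral_value b u = numeral_value b v \<longleftrightarrow> u = v"
  using assms
proof (induction u arbitrary: v rule: rev_induct)
  case Nil
  then show ?case by (cases v rule: rev_cases) (auto simp: numeral_value_Nil numeral_value_snoc)
next
  case (snoc a u)
  show ?case
  proof (cases v rule: rev_cases)
    case Nil
    then show ?thesis by (auto simp: numeral_value_Nil numeral_value_snoc)
  next
    case (snoc v' a')
    have small: "Suc a < b" "Suc a' < b" using snoc.prems[of a] snoc.prems[of a'] snoc by auto
    have "u = v' \<and> a = a'" if eq: "b * numeral_value b u + Suc a = b * numeral_value b v' + Suc a'"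
    proof -
      have "Suc a = (b * numeral_value b u + Suc a) mod b" using small by simp
      also have "\<dots> = Suc a'" unfolding eq using small by simp
      finally have "a = a'" by simp
      moreover have "numeral_value b u = numeral_value b v'" using eq small \<open>a = a'\<close> by simp
      then have "u = v'" using snoc.IH[of v'] snoc.prems snoc by auto
      ultimately show ?thesis by simp
    qed
    then show ?thesis using snoc by (auto simp: numeral_value_snoc)
  qed
qed

fun lookup :: "(nat \<times> int) list \<Rightarrow> nat \<Rightarrow> int" where
  "lookup [] k = 0"
| "lookup ((l, x) # xs) k = (if l = k then x else lookup xs k)"

lemma lookup_notin: "k \<notin> fst ` set xs \<Longrightarrow> lookup xs k = 0"
  by (induction xs k rule: lookup.induct) auto

definition sparse_mat :: "nat \<Rightarrow> (nat \<Rightarrow> (nat \<times> int) list) \<Rightarrow> int mat" where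
  "sparse_mat N entries = mat N N (\<lambda>(i, k). lookup (entries i) k)"

lemma sparse_mat_carrier: "sparse_mat N entries \<in> carrier_mat N N"
  by (simp add: sparse_mat_def)

lemma sum_lookup:
  fixes f :: "nat \<Rightarrow> int"
  assumes "distinct (map fst xs)" "fst ` set xs \<subseteq> {..<N}"
  shows "(\<Sum>l = 0..<N. lookup xs l * f l) = (\<Sum>(l, x)\<leftarrow>xs. x * f l)"
  using assms
proof (induction xs)
  case (Cons p xs)
  obtain k x where p: "p = (k, x)" by force
  have "lookup xs k = 0" using Cons.prems p by (intro lookup_notin) auto
  then have "(\<Sum>l = 0..<N. lookup (p # xs) l * f l) =
      (\<Sum>l = 0..<N. (if l = k then x * f l else 0) + lookup xs l * f l)"
    by (intro sum.cong) (auto simp: p)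
  also have "\<dots> = x * f k + (\<Sum>(l, x)\<leftarrow>xs. x * f l)"
    using Cons p by (simp add: sum.distrib)
  finally show ?case by (simp add: p)
qed simp

lemma sparse_mat_mult:
  assumes "B \<in> carrier_mat N M" "i < N" "m < M"
    "distinct (map fst (entries i))" "fst ` set (entries i) \<subseteq> {..<N}"
  shows "(sparse_mat N entries * B) $$ (i, m) = (\<Sum>(l, x)\<leftarrow>entries i. x * B $$ (l, m))"
proof -
  have "(sparse_mat N entries * B) $$ (i, m) =
      (\<Sum>l = 0..<N. lookup (entries i) l * B $$ (l, m))"
    using assms(1-3) by (auto simp: sparse_mat_def scalar_prod_def intro!: sum.cong)
  then show ?thesis using sum_lookup[OF assms(4,5)] by simp
qed

text \<open>
  Letters are unbounded, so the base has to be computed from the instance; every letter that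
  occurs is at most the code, and shifted by one it is a digit below the base.
\<close>

definition base :: "(word \<times> word) list \<Rightarrow> nat" where
  "base ps = pcp_code ps + 2"

text \<open>
  Block \<open>j\<close> occupies the indices \<open>1 + 3 * j\<close> to \<open>3 + 3 * j\<close>.  On it the first matrix acts by

  \<open>(b ^ |u|, 0, 0)\<close>, \<open>(0, b ^ |v|, 0)\<close>, \<open>(value u, value v, 1)\<close>

  where \<open>(u, v)\<close> is the \<open>j\<close>-th pair and \<open>value\<close> stands for the numeral.  In the last column it has
  the product of this block with the vector \<open>(1, -1, 0)\<close>.
\<close>

definition act_entries :: "nat \<Rightarrow> (word \<times> word) list \<Rightarrow> nat \<Rightarrow> nat \<Rightarrow> (nat \<times> int) list" where
  "act_entries r ps j c = (let b = base ps; u = fst (ps ! j); v = snd (ps ! j) in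
     if c = 0 then [(1 + 3 * j, int (b ^ length u)), (3 * r + 1, int (b ^ length u))]
     else if c = 1 then [(2 + 3 * j, int (b ^ length v)), (3 * r + 1, - int (b ^ length v))]
     else [(1 + 3 * j, int (numeral_value b u)), (2 + 3 * j, int (numeral_value b v)), (3 + 3 * j, 1),
       (3 * r + 1, int (numeral_value b u) - int (numeral_value b v))])"

text \<open>
  The second matrix passes from block \<open>j\<close> to the next one in cyclic order.  In the last column it has
  the vector \<open>(0, 0, 1)\<close> in each block.
\<close>

definition shift_entries :: "nat \<Rightarrow> nat \<Rightarrow> nat \<Rightarrow> (nat \<times> int) list" where
  "shift_entries r j c = (let j' = Suc j mod r in
     if c = 2 then [(3 + 3 * j', 1), (3 * r + 1, 1)] else [(1 + 3 * j' + c, 1)])"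

text \<open>
  Row \<open>0\<close> repeats the last row of block \<open>0\<close>, so the corner of a product is the corresponding entry of
  that block.  The last row is zero, so the last column of a factor other than the last one
  contributes nothing.
\<close>

definition block_entries :: "nat \<Rightarrow> (nat \<Rightarrow> nat \<Rightarrow> (nat \<times> int) list) \<Rightarrow> nat \<Rightarrow> (nat \<times> int) list" where
  "block_entries r e i = (if i = 0 then e 0 2 else
      if i \<le> 3 * r then e ((i - 1) div 3) ((i - 1) mod 3) else [])"

lemma block_entries_block:
  assumes "j < r"
  shows "block_entries r e (1 + 3 * j) = e j 0" "block_entries r e (2 + 3 * j) = e j 1"
    "block_entries r e (3 + 3 * j) = e j 2"
proof -
  have "(1 + 3 * j) div 3 = j" "(1 + 3 * j) mod 3 = 1" "(2 + 3 * j) div 3 = j" "(2 + 3 * j) mod 3 = 2"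
    by presburger+
  then show "block_entries r e (1 + 3 * j) = e j 0" "block_entries r e (2 + 3 * j) = e j 1"
    "block_entries r e (3 + 3 * j) = e j 2"
    using assms by (auto simp: block_entries_def)
qed

definition corner_matrices :: "(word \<times> word) list \<Rightarrow> int mat list" where
  "corner_matrices ps = (let r = length ps in
     [sparse_mat (3 * r + 2) (block_entries r (act_entries r ps)), sparse_mat (3 * r + 2)
         (block_entries r (shift_entries r))])"

lemma corner_matrices_instance: "corner_matrices ps \<in> zc_instances 2 (3 * length ps + 2)"
  by (simp add: corner_matrices_def zc_instances_def Let_def sparse_mat_carrier)

text \<open>
  A product of the two matrices, read from the left, is a walk through the blocks that applies the
  blocks visited by the first matrix.  Every nonempty sequence of indices arises from a product that
  ends in the first matrix.
\<close>

fun visited :: "nat \<Rightarrow> nat list \<Rightarrow> nat \<Rightarrow> nat list" where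
  "visited r [] j = []"
| "visited r (0 # w) j = j # visited r w j"
| "visited r (Suc _ # w) j = visited r w (Suc j mod r)"

lemma visited_less: "j < r \<Longrightarrow> set (visited r w j) \<subseteq> {..<r}"
  by (induction r w j rule: visited.induct) auto

lemma visited_nonempty: "0 \<in> set w \<Longrightarrow> visited r w j \<noteq> []"
  by (induction r w j rule: visited.induct) auto

lemma visited_shift: "j < r \<Longrightarrow> visited r (replicate k (Suc 0) @ w) j = visited r w ((j + k) mod r)"
proof (induction k arbitrary: j)
  case (Suc k)
  then have "Suc j mod r < r" by simp
  with Suc show ?case by (simp add: mod_add_left_eq)
qed simp

lemma visited_surj:
  assumes "is \<noteq> []" "set is \<subseteq> {..<r}" "j < r"
  shows "\<exists>w. w \<noteq> [] \<and> set w \<subseteq> {..<2} \<and> last w = 0 \<and> visited r w j = is"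
  using assms
proof (induction "is" arbitrary: j rule: list_nonempty_induct)
  case (single i)
  \<comment> \<open>This many shifts lead from block \<open>j\<close> to block \<open>i\<close>; adding \<open>r\<close> keeps the difference from
      truncating.\<close>
  have "(j + (i + r - j)) mod r = i" using single by simp
  then have "visited r (replicate (i + r - j) (Suc 0) @ [0]) j = [i]"
      using single by (simp add: visited_shift)
  then show ?case by (intro exI[of _ "replicate (i + r - j) (Suc 0) @ [0]"]) auto
next
  case (cons i "is")
  then obtain w where w: "w \<noteq> []" "set w \<subseteq> {..<2}" "last w = 0" "visited r w i = is" by auto
  have "(j + (i + r - j)) mod r = i" using cons by simp
  then have "visited r (replicate (i + r - j) (Suc 0) @ 0 # w) j = i # is"
    using cons w by (simp add: visited_shift)
  with w show ?case by (intro exI[of _ "replicate (i + r - j) (Suc 0) @ 0 # w"]) auto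
qed

context
  fixes ps :: "(word \<times> word) list"
  assumes ps: "ps \<noteq> []"
begin

definition "column w l = foldr (\<lambda>i B. corner_matrices ps ! i * B) w (1\<^sub>m (3 * length ps + 2)) $$ (l,
    3 * length ps + 1)"

lemma column_Nil: "l < 3 * length ps + 2 \<Longrightarrow> column [] l = (if l = 3 * length ps + 1 then 1 else 0)"
  by (simp add: column_def)

lemma foldr_carrier:
  "set w \<subseteq> {..<2} \<Longrightarrow> foldr (\<lambda>i B. corner_matrices ps ! i * B) w (1\<^sub>m (3 * length ps + 2)) \<in>
    carrier_mat (3 * length ps + 2) (3 * length ps + 2)"
proof (induction w)
  case (Cons i w)
  have "corner_matrices ps ! i \<in> carrier_mat (3 * length ps + 2) (3 * length ps + 2)"
    using Cons.prems corner_matrices_instance[of ps] by (auto simp: zc_instances_def)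
  with Cons show ?case by auto
qed simp

lemma column_act:
  assumes "set w \<subseteq> {..<2}" "l < 3 * length ps + 2"
  shows "column (0 # w) l =
      (\<Sum>(k, x)\<leftarrow>block_entries (length ps) (act_entries (length ps) ps) l. x * column w k)"
proof -
  have "distinct (map fst (act_entries (length ps) ps j c))" "fst ` set (act_entries (length ps) ps
      j c) \<subseteq> {..<3 * length ps + 2}"
    if "j < length ps" for j c
    using that by (auto simp: act_entries_def Let_def)
  moreover have "(l - 1) div 3 < length ps" if "l \<le> 3 * length ps" "l \<noteq> 0" using that by auto
  ultimately have "distinct (map fst (block_entries (length ps) (act_entries (length ps) ps) l))"
    "fst ` set (block_entries (length ps) (act_entries (length ps) ps) l) \<subseteq> {..<3 * length ps + 2}"
    using ps by (cases "l = 0"; cases "l \<le> 3 * length ps"; simp add: block_entries_def)+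
  then show ?thesis
    using sparse_mat_mult[OF foldr_carrier[OF assms(1)] assms(2)]
    by (simp add: column_def corner_matrices_def Let_def)
qed

lemma column_shift:
  assumes "set w \<subseteq> {..<2}" "l < 3 * length ps + 2"
  shows "column (1 # w) l =
      (\<Sum>(k, x)\<leftarrow>block_entries (length ps) (shift_entries (length ps)) l. x * column w k)"
proof -
  have "distinct (map fst (shift_entries (length ps) j c))" "fst ` set (shift_entries (length ps) j
      c) \<subseteq> {..<3 * length ps + 2}"
    if "c < 3" for j c
  proof -
    have "Suc j mod length ps < length ps" using ps by simp
    then show "distinct (map fst (shift_entries (length ps) j c))"
        "fst ` set (shift_entries (length ps) j c) \<subseteq> {..<3 * length ps + 2}"
      using that by (auto simp: shift_entries_def Let_def)
  qed
  then have "distinct (map fst (block_entries (length ps) (shift_entries (length ps)) l))"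
    "fst ` set (block_entries (length ps) (shift_entries (length ps)) l) \<subseteq> {..<3 * length ps + 2}"
    by (cases "l = 0"; cases "l \<le> 3 * length ps"; simp add: block_entries_def)+
  then show ?thesis
    using sparse_mat_mult[OF foldr_carrier[OF assms(1)] assms(2)]
    by (simp add: column_def corner_matrices_def Let_def)
qed

abbreviation "top_word w j \<equiv> concat (map (\<lambda>i. fst (ps ! i)) (visited (length ps) w j))"
abbreviation "bottom_word w j \<equiv> concat (map (\<lambda>i. snd (ps ! i)) (visited (length ps) w j))"

text \<open>
  The last column of a product, by induction from the right.  If the last factor is the first matrix,
  the vector \<open>(1, -1, 0)\<close> is transformed by the visited blocks, and its last component becomes the
  difference of the two numerals.  If it is the second matrix, the vector \<open>(0, 0, 1)\<close> is fixed by all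
  blocks, so the corner is \<open>1\<close>.  This rules out products that visit no block: with \<open>(1, -1, 0)\<close> there,
  they would have a zero corner.
\<close>

lemma column_invariant:
  assumes "set w \<subseteq> {..<2}" "w \<noteq> []"
  shows "column w (3 * length ps + 1) = 0 \<and> column w 0 = column w 3 \<and> (\<forall>j<length ps.
    (if last w = 0 then column w (1 + 3 * j) = int (base ps ^ length (top_word w j)) \<and>
       column w (2 + 3 * j) = - int (base ps ^ length (bottom_word w j)) \<and>
       column w (3 + 3 * j) = int (numeral_value (base ps) (top_word w j)) - int (numeral_value
           (base ps) (bottom_word w j))
     else column w (1 + 3 * j) = 0 \<and> column w (2 + 3 * j) = 0 \<and> column w (3 + 3 * j) = 1))"
  using assms
proof (induction w)
  case (Cons i w)
  have w: "set w \<subseteq> {..<2}" using Cons.prems by simp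
  have N: "3 * length ps + 1 < 3 * length ps + 2" "0 < 3 * length ps + 2" "3 < 3 * length ps + 2"
    "j < length ps \<Longrightarrow> 1 + 3 * j < 3 * length ps + 2" "j < length ps \<Longrightarrow> 2 + 3 * j < 3 * length ps + 2"
    "j < length ps \<Longrightarrow> 3 + 3 * j < 3 * length ps + 2" for j
    using ps by (cases ps; auto)+
  have zero: "0 < length ps" using ps by simp
  have first: "block_entries (length ps) e 0 = e 0 2" "block_entries (length ps) e 3 = e 0 2"
      "block_entries (length ps) e (3 * length ps + 1) = []" for e
    using block_entries_block(3)[OF zero, of e] by (simp_all add: block_entries_def)
  consider "i = 0" | "i = 1" using Cons.prems by (auto simp: less_2_cases_iff)
  then show ?case
  proof cases
    case 1
    have col: "column (i # w) (3 * length ps + 1) = 0" "column (i # w) 0 = column (i # w) 3"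
      unfolding 1 by (simp_all only: column_act[OF w N(1)] column_act[OF w N(2)] column_act[OF w
          N(3)] first) simp
    have step: "column (i # w) (1 + 3 * j) = int (base ps ^ length (fst (ps ! j))) * (column w (1 +
        3 * j) + column w (3 * length ps + 1))"
      "column (i # w) (2 + 3 * j) = int (base ps ^ length (snd (ps ! j))) * (column w (2 + 3 * j) -
          column w (3 * length ps + 1))"
      "column (i # w) (3 + 3 * j) = int (numeral_value (base ps) (fst (ps ! j))) * (column w (1 + 3
          * j) + column w (3 * length ps + 1)) +
        int (numeral_value (base ps) (snd (ps ! j))) * (column w (2 + 3 * j) - column w (3 * length
            ps + 1)) + column w (3 + 3 * j)"
      if "j < length ps" for j
      unfolding 1 column_act[OF w N(4)[OF that]] column_act[OF w N(5)[OF that]] column_act[OF w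
          N(6)[OF that]]
        block_entries_block[OF that] by (simp_all add: act_entries_def Let_def algebra_simps)
    show ?thesis
    proof (cases "w = []")
      case True
      then show ?thesis using col step N 1 by (auto simp: column_Nil)
    next
      case False
      then show ?thesis using Cons.IH[OF w] col step 1
        by (auto simp: numeral_value_append power_add algebra_simps)
    qed
  next
    case 2
    have col: "column (i # w) (3 * length ps + 1) = 0" "column (i # w) 0 = column (i # w) 3"
      unfolding 2 by (simp_all only: column_shift[OF w N(1)] column_shift[OF w N(2)] column_shift[OF
          w N(3)] first) simp
    let ?next = "\<lambda>j. Suc j mod length ps"
    have step: "column (i # w) (1 + 3 * j) = column w (1 + 3 * ?next j)"
      "column (i # w) (2 + 3 * j) = column w (2 + 3 * ?next j)"
      "column (i # w) (3 + 3 * j) = column w (3 + 3 * ?next j) + column w (3 * length ps + 1)"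
      if "j < length ps" for j
      unfolding 2 column_shift[OF w N(4)[OF that]] column_shift[OF w N(5)[OF that]] column_shift[OF
          w N(6)[OF that]]
        block_entries_block[OF that] by (simp_all add: shift_entries_def Let_def)
    have next_less: "?next j < length ps" for j using zero by simp
    show ?thesis
    proof (cases "w = []")
      case True
      have "Suc (3 * ?next j) \<noteq> 3 * length ps" "Suc (Suc (3 * ?next j)) \<noteq> 3 * length ps"
        "?next j \<noteq> length ps" for j
        using next_less[of j] by arith+
      then show ?thesis using col step N(4,5,6)[OF next_less] next_less 2 True
          by (auto simp: column_Nil)
    next
      case False
      then show ?thesis using Cons.IH[OF w] col step next_less 2 by auto
    qed
  qed
qed simp

lemma letter_less_base:
  assumes "j < length ps" "a \<in> set (fst (ps ! j)) \<union> set (snd (ps ! j))"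
  shows "Suc a < base ps"
proof -
  have member: "x \<in> set xs \<Longrightarrow> x \<le> list_encode xs" for x xs
    by (induction xs) (auto intro: le_trans[OF _ le_prod_encode_2] le_SucI le_prod_encode_1)
  let ?u = "list_encode (fst (ps ! j))" and ?v = "list_encode (snd (ps ! j))"
  have "a \<le> ?u \<or> a \<le> ?v" using assms(2) member by blast
  then have "a \<le> pair ?u ?v" using le_prod_encode_1[of ?u ?v] le_prod_encode_2[of ?v ?u] by linarith
  also have "\<dots> \<le> pcp_code ps"
    unfolding pcp_code_def using nth_mem[OF assms(1)]
    by (intro member) (auto simp: case_prod_unfold intro!: image_eqI[of _ _ "ps ! j"])
  finally show ?thesis by (simp add: base_def)
qed

theorem zc_solvable_corner_matrices:
  "zc_solvable (3 * length ps + 2) (corner_matrices ps) \<longleftrightarrow> pcp_solvable ps"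
proof -
  have zc: "zc_solvable (3 * length ps + 2) (corner_matrices ps) \<longleftrightarrow>
      (\<exists>w. w \<noteq> [] \<and> set w \<subseteq> {..<2} \<and> column w 0 = 0)"
    by (simp add: zc_solvable_def column_def corner_matrices_def Let_def numeral_2_eq_2)
  have r: "0 < length ps" using ps by simp
  have corner: "column w 0 = 0 \<longleftrightarrow> last w = 0 \<and> top_word w 0 = bottom_word w 0"
    if w: "w \<noteq> []" "set w \<subseteq> {..<2}" for w
  proof -
    have "Suc a < base ps" if "a \<in> set (top_word w 0) \<union> set (bottom_word w 0)" for a
      using that visited_less[OF r, of w] letter_less_base by fastforce
    then have "numeral_value (base ps) (top_word w 0) = numeral_value (base ps) (bottom_word w 0) \<longleftrightarrow>
        top_word w 0 = bottom_word w 0"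
      by (rule numeral_value_inject)
    then show ?thesis
      using column_invariant[OF w(2,1)] r by (auto split: if_splits dest!: spec[of _ 0])
  qed
  show ?thesis
  proof
    assume "zc_solvable (3 * length ps + 2) (corner_matrices ps)"
    then obtain w where w: "w \<noteq> []" "last w = 0" "top_word w 0 = bottom_word w 0"
      using zc corner by blast
    then have "visited (length ps) w 0 \<noteq> []" by (metis visited_nonempty last_in_set)
    with w visited_less[OF r] show "pcp_solvable ps" unfolding pcp_solvable_def by blast
  next
    assume "pcp_solvable ps"
    then obtain "is" where "is": "is \<noteq> []" "set is \<subseteq> {..<length ps}"
        "concat (map (\<lambda>i. fst (ps ! i)) is) = concat (map (\<lambda>i. snd (ps ! i)) is)"
      unfolding pcp_solvable_def by blast
    then obtain w where w: "w \<noteq> []" "set w \<subseteq> {..<2}" "last w = 0" "visited (length ps) w 0 = is"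
      using visited_surj r by blast
    then have "column w 0 = 0" using corner "is"(3) by simp
    with w zc show "zc_solvable (3 * length ps + 2) (corner_matrices ps)" by blast
  qed
qed

end

definition computable_nat_on :: "nat \<Rightarrow> ((word \<times> word) list \<Rightarrow> nat) \<Rightarrow> bool" where
  "computable_nat_on r g \<longleftrightarrow> (\<exists>h. computable h \<and> (\<forall>ps. length ps = r \<longrightarrow> g ps = h (pcp_code ps)))"

text \<open>
  Integers are kept as differences of natural numbers until they are coded.
\<close>

definition computable_int_on :: "nat \<Rightarrow> ((word \<times> word) list \<Rightarrow> int) \<Rightarrow> bool" where
  "computable_int_on r g \<longleftrightarrow>
      (\<exists>a b. computable_nat_on r a \<and> computable_nat_on r b \<and> (\<forall>ps. g ps = int (a ps) - int (b ps)))"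

lemma computable_nat_onI:
  "computable h \<Longrightarrow> (\<And>ps. length ps = r \<Longrightarrow> g ps = h (pcp_code ps)) \<Longrightarrow> computable_nat_on r g"
  unfolding computable_nat_on_def by blast

lemma computable_nat_on_const: "computable_nat_on r (\<lambda>_. c)"
  unfolding computable_nat_on_def using computable_const by blast

lemma computable_int_on_diff:
  "computable_nat_on r a \<Longrightarrow> computable_nat_on r b \<Longrightarrow> computable_int_on r (\<lambda>ps. int (a ps) - int (b ps))"
  unfolding computable_int_on_def by blast

lemma computable_int_on_int: "computable_nat_on r a \<Longrightarrow> computable_int_on r (\<lambda>ps. int (a ps))"
  using computable_int_on_diff[of r a "\<lambda>_. 0"] computable_nat_on_const by simp

lemma computable_int_on_uminus_int: "computable_nat_on r a \<Longrightarrow> computable_int_on r (\<lambda>ps. - int (a ps))"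
  using computable_int_on_diff[of r "\<lambda>_. 0" a] computable_nat_on_const by simp

lemma computable_int_on_0: "computable_int_on r (\<lambda>_. 0)" and computable_int_on_1: "computable_int_on
    r (\<lambda>_. 1)"
  using computable_int_on_int[OF computable_nat_on_const[of r 0]]
    computable_int_on_int[OF computable_nat_on_const[of r 1]] by simp_all

lemma int_encode_diff: "int_encode (int a - int b) =
    (if a < b then Suc (2 * (b - a - 1)) else 2 * (a - b))"
  by (auto simp: int_encode_def sum_encode_def nat_diff_distrib)

lemma computable_int_encode:
  assumes "computable_int_on r g"
  shows "computable_nat_on r (\<lambda>ps. int_encode (g ps))"
proof -
  obtain a b where ab: "computable a" "computable b"
      and g: "\<And>ps. length ps = r \<Longrightarrow> g ps = int (a (pcp_code ps)) - int (b (pcp_code ps))"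
    using assms unfolding computable_int_on_def computable_nat_on_def by metis
  have "computable (\<lambda>x. if a x < b x then Suc (2 * (b x - a x - 1)) else 2 * (a x - b x))"
    by (intro computable_intros ab)
  then show ?thesis
    by (rule computable_nat_onI) (simp only: g int_encode_diff)
qed

lemma computable_nat_on_list_encode:
  assumes "\<And>i. i \<in> set is \<Longrightarrow> computable_nat_on r (g i)"
  shows "computable_nat_on r (\<lambda>ps. list_encode (map (\<lambda>i. g i ps) is))"
proof -
  obtain h where h: "\<And>i. i \<in> set is \<Longrightarrow> computable (h i)"
      "\<And>i ps. i \<in> set is \<Longrightarrow> length ps = r \<Longrightarrow> g i ps = h i (pcp_code ps)"
    using assms unfolding computable_nat_on_def by metis
  have "computable (\<lambda>x. list_encode (map (\<lambda>i. h i x) is))"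
    by (rule computable_list_encode_map[OF h(1)])
  moreover have "list_encode (map (\<lambda>i. g i ps) is) = list_encode (map (\<lambda>i. h i (pcp_code ps)) is)"
    if "length ps = r" for ps
    using h(2) that by (simp cong: map_cong)
  ultimately show ?thesis unfolding computable_nat_on_def by blast
qed

lemma computable_nat_on_word_fold:
  assumes "computable (\<lambda>z. h (proj1 z) (proj1 (proj2 z)) (proj2 (proj2 z)))" "j < r"
  shows "computable_nat_on r (\<lambda>ps. foldl (h (pcp_code ps)) c (fst (ps ! j)))"
    and "computable_nat_on r (\<lambda>ps. foldl (h (pcp_code ps)) c (snd (ps ! j)))"
proof -
  have nth: "code_nth (pcp_code ps) j = pair (list_encode (fst (ps ! j))) (list_encode (snd (ps !
      j)))"
    if "length ps = r" for ps
    using assms(2) that unfolding pcp_code_def by (simp add: code_nth_list_encode case_prod_unfold)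
  have comp: "computable (\<lambda>x. foldl (h x) c (list_decode (proj1 (code_nth x j))))"
    "computable (\<lambda>x. foldl (h x) c (list_decode (proj2 (code_nth x j))))"
    by (intro computable_foldl assms(1) computable_proj1 computable_proj2 computable_code_nth
        computable_id computable_const)+
  show "computable_nat_on r (\<lambda>ps. foldl (h (pcp_code ps)) c (fst (ps ! j)))"
    by (rule computable_nat_onI[OF comp(1)]) (simp add: nth)
  show "computable_nat_on r (\<lambda>ps. foldl (h (pcp_code ps)) c (snd (ps ! j)))"
    by (rule computable_nat_onI[OF comp(2)]) (simp add: nth)
qed

lemma computable_nat_on_power:
  assumes "j < r"
  shows "computable_nat_on r (\<lambda>ps. base ps ^ length (fst (ps ! j)))"
    and "computable_nat_on r (\<lambda>ps. base ps ^ length (snd (ps ! j)))"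
proof -
  have fold: "foldl (\<lambda>s a. b * s) c u = b ^ length u * c" for b c :: nat and u :: word
    by (induction u arbitrary: c) (simp_all add: ac_simps)
  have power: "base ps ^ length u = foldl (\<lambda>s a. (pcp_code ps + 2) * s) 1 u" for ps and u :: word
    using fold[of "pcp_code ps + 2" 1 u] by (simp only: base_def mult_1_right)
  have comp: "computable (\<lambda>z. (proj1 z + 2) * proj1 (proj2 z))"
    by (intro computable_mult computable_add computable_proj1 computable_proj2 computable_const
        computable_id)
  note fold = computable_nat_on_word_fold[of "\<lambda>x s a. (x + 2) * s" j r 1, OF comp assms]
  show "computable_nat_on r (\<lambda>ps. base ps ^ length (fst (ps ! j)))"
    "computable_nat_on r (\<lambda>ps. base ps ^ length (snd (ps ! j)))"
    unfolding power by (rule fold)+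
qed

lemma computable_nat_on_value:
  assumes "j < r"
  shows "computable_nat_on r (\<lambda>ps. numeral_value (base ps) (fst (ps ! j)))"
    and "computable_nat_on r (\<lambda>ps. numeral_value (base ps) (snd (ps ! j)))"
proof -
  have comp: "computable (\<lambda>z. (proj1 z + 2) * proj1 (proj2 z) + Suc (proj2 (proj2 z)))"
    by (intro computable_Suc computable_mult computable_add computable_proj1 computable_proj2
        computable_const computable_id)
  note fold = computable_nat_on_word_fold[of "\<lambda>x s a. (x + 2) * s + Suc a" j r 0, OF comp assms]
  show "computable_nat_on r (\<lambda>ps. numeral_value (base ps) (fst (ps ! j)))"
    "computable_nat_on r (\<lambda>ps. numeral_value (base ps) (snd (ps ! j)))"
    unfolding numeral_value_def base_def by (rule fold)+
qed

lemma computable_lookup_Nil: "computable_int_on r (\<lambda>ps. lookup [] k)"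
  by (simp add: computable_int_on_0)

lemma computable_lookup_Cons:
  "computable_int_on r x \<Longrightarrow> computable_int_on r (\<lambda>ps. lookup (xs ps) k) \<Longrightarrow>
    computable_int_on r (\<lambda>ps. lookup ((l, x ps) # xs ps) k)"
  by (cases "l = k") simp_all

lemma computable_act_entries:
  assumes "j < r"
  shows "computable_int_on r (\<lambda>ps. lookup (act_entries r ps j c) k)"
proof -
  note rules = computable_lookup_Cons computable_lookup_Nil computable_int_on_diff
    computable_int_on_uminus_int computable_int_on_int computable_int_on_1
    computable_nat_on_power[OF assms] computable_nat_on_value[OF assms]
  consider "c = 0" | "c = 1" | "c \<noteq> 0" "c \<noteq> 1" by blast
  then show ?thesis
  proof cases
    case 1
    show ?thesis unfolding act_entries_def Let_def 1 if_P[OF refl] by (intro rules)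
  next
    case 2
    have "c \<noteq> 0" using 2 by simp
    show ?thesis unfolding act_entries_def Let_def if_not_P[OF \<open>c \<noteq> 0\<close>] if_P[OF 2] by (intro rules)
  next
    case 3
    show ?thesis unfolding act_entries_def Let_def if_not_P[OF 3(1)] if_not_P[OF 3(2)]
        by (intro rules)
  qed
qed

lemma computable_int_on_const: "computable_int_on r (\<lambda>_. x)"
proof -
  have "computable_int_on r (\<lambda>_. int (nat x) - int (nat (- x)))"
    by (intro computable_int_on_diff computable_nat_on_const)
  moreover have "int (nat x) - int (nat (- x)) = x" by simp
  ultimately show ?thesis by simp
qed

lemma list_encode_sparse_mat:
  "list_encode (map (\<lambda>row. list_encode (map int_encode row)) (mat_to_list (sparse_mat N e))) =
    list_encode (map (\<lambda>i. list_encode (map (\<lambda>k. int_encode (lookup (e i) k)) [0..<N])) [0..<N])"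
  unfolding mat_to_list_def map_map comp_def
  by (intro arg_cong[where f = list_encode] map_cong) (auto simp: sparse_mat_def)

text \<open>
  The dimension is fixed by the number of pairs, so the matrix code is a list of fixed shape whose
  entries are computed separately.
\<close>

lemma computable_corner_matrices:
  assumes "0 < r"
  obtains f where "\<And>ps. length ps = r \<Longrightarrow> rec_eval f [pcp_code ps] (zc_code (corner_matrices ps))"
proof -
  let ?N = "3 * r + 2"
  define entry where "entry m i k ps = lookup (block_entries r (if m = 0 then act_entries r ps else
      shift_entries r) i) k"
    for m i k :: nat and ps
  have entry: "computable_int_on r (entry m i k)" for m i k
  proof (cases "m = 0 \<and> i \<le> 3 * r")
    case True
    then have "i \<noteq> 0 \<Longrightarrow> (i - 1) div 3 < r" by auto
    then have "computable_int_on r (\<lambda>ps. lookup (act_entries r ps (if i = 0 then 0 else (i - 1) div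
        3) (if i = 0 then 2 else (i - 1) mod 3)) k)"
      using assms by (intro computable_act_entries) auto
    moreover have "entry m i k =
        (\<lambda>ps. lookup (act_entries r ps (if i = 0 then 0 else (i - 1) div 3) (if i = 0 then 2 else (i
            - 1) mod 3)) k)"
      using True by (auto simp: entry_def block_entries_def)
    ultimately show ?thesis by simp
  next
    case False
    then have "(\<lambda>_. entry m i k []) = entry m i k"
      by (auto simp: entry_def block_entries_def)
    then show ?thesis using computable_int_on_const[of r "entry m i k []"] by simp
  qed
  let ?code = "\<lambda>ps. list_encode (map (\<lambda>m. list_encode (map (\<lambda>i. list_encode (map (\<lambda>k.
      int_encode (entry m i k ps)) [0..<?N])) [0..<?N])) [0, 1])"
  have "computable_nat_on r ?code"
    by (intro computable_nat_on_list_encode computable_int_encode entry)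
  then obtain h where "computable h" and h: "\<And>ps. length ps = r \<Longrightarrow> ?code ps = h (pcp_code ps)"
    unfolding computable_nat_on_def by blast
  then obtain f where f: "\<And>x. rec_eval f [x] (h x)" unfolding computable_def by blast
  have "zc_code (corner_matrices ps) = ?code ps" if "length ps = r" for ps
    using that
    by (simp add: zc_code_def corner_matrices_def list_encode_sparse_mat entry_def Let_def
        del: upt.simps upt_Suc list_encode.simps)
  then show ?thesis by (intro that[of f]) (simp only: h f)
qed

section \<open>The minimal number of pairs\<close>

lemma pcp_decidable_0: "pcp_decidable 0"
proof -
  have "\<not> pcp_solvable []" by (auto simp: pcp_solvable_def)
  then show ?thesis
    unfolding pcp_decidable_def decidable_def pcp_instances_def
    by (intro exI[of _ Zero]) (auto intro: rec_eval.zero)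
qed

theorem corollary4: "\<not> zc_decidable 2 (3 * n_P + 2)"
proof
  assume "zc_decidable 2 (3 * n_P + 2)"
  then obtain d where d: "\<And>As. As \<in> zc_instances 2 (3 * n_P + 2) \<Longrightarrow>
      rec_eval d [zc_code As] (if zc_solvable (3 * n_P + 2) As then 1 else 0)"
    unfolding zc_decidable_def decidable_def by blast
  have undecidable: "\<not> pcp_decidable n_P"
    unfolding n_P_def by (rule LeastI_ex[OF pcp_undecidable])
  then have "n_P \<noteq> 0" using pcp_decidable_0 by metis
  then obtain f where f: "\<And>ps. length ps = n_P \<Longrightarrow>
      rec_eval f [pcp_code ps] (zc_code (corner_matrices ps))"
    using computable_corner_matrices[of n_P] by blast
  have "rec_eval (Comp d [f]) [pcp_code ps] (if pcp_solvable ps then 1 else 0)"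
    if "length ps = n_P" for ps
  proof -
    have "ps \<noteq> []" using that \<open>n_P \<noteq> 0\<close> by auto
    then show ?thesis
      using rec_eval_Comp1[OF f[OF that] d] corner_matrices_instance[of ps]
        zc_solvable_corner_matrices[of ps] that by simp
  qed
  then have "pcp_decidable n_P"
    unfolding pcp_decidable_def decidable_def pcp_instances_def by blast
  with undecidable show False ..
qed

end
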